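(* Let $n\ge1$ and $d\ge0$ be integers. There are coefficients $c_{\alpha,\beta}$ (depending only on $n,d,\alpha,\beta$), indexed by multi-indices $\alpha\in\mathbb{Z}_{\ge0}^n$ with $1\le|\alpha|\le d+1$ and $\beta\in\Sigma_\alpha$, such that for every $C^{d+1}$-smooth function $f:B^n\to\mathbb{R}$ and every $C^{d+1}$-smooth curve $\omega=(\omega_1,\ldots,\omega_n):[-1,1]\to B^n$, the function $g(t)=f(\omega(t))$ satisfies, for all $t\in[-1,1]$, $$g^{(d+1)}(t)=\sum_{1\le|\alpha|\le d+1}f^{(\alpha)}(\omega(t))\sum_{\beta\in\Sigma_\alpha}c_{\alpha,\beta}\,(D\omega_\alpha)^\beta ,$$ and moreover: (i) Each monomial $(D\omega_\alpha)^\beta$ in this formula has total degree $|\alpha|$ if every derivative of $\omega$ is assigned degree $1$ independently of its order, and has total degree $d+1$ if the derivatives of $\omega$ of order $k$ are assigned degree $k$. (ii) All the coefficients $c_{\alpha,\beta}$ are nonzero integers. Their sum is bounded by $(n+1)^{d+1}(d+1)^{(d+1)(n+2)}$, as well as each $c_{\alpha,\beta}$, and the total number of terms (pairs $(\alpha,\beta)$) in the formula. (iii) Each monomial $(D\omega_\alpha)^\beta$ in the formula necessarily contains a derivative of $\omega$ of order at least $\kappa_\alpha$ (that is, $\beta_i^j>0$ for some $i$ and some $j\ge\kappa_\alpha$). In particular, for $|\alpha|\le d$ each monomial $(D\omega_\alpha)^\beta$ necessarily contains a derivative of $\omega$ of order at least two.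
   Context: $B^n\subset\mathbb{R}^n$ is the closed unit ball; $C^{d+1}$-smooth on $B^n$ means all partial derivatives of order at most $d+1$ exist and extend continuously up to the boundary. For $\alpha=(\alpha_1,\ldots,\alpha_n)\in\mathbb{Z}_{\ge0}^n$, $|\alpha|=\alpha_1+\cdots+\alpha_n$ and $f^{(\alpha)}=\partial^{|\alpha|}f/\partial x_1^{\alpha_1}\cdots\partial x_n^{\alpha_n}$. For $1\le|\alpha|\le d+1$ put $N_\alpha=d+2-|\alpha|$ and let $D\omega_\alpha=(\omega_i^{(j)})_{1\le i\le n,\,1\le j\le N_\alpha}$ be the vector of derivatives (at $t$) of the coordinates of $\omega$ of orders $1,\ldots,N_\alpha$. For $\beta=(\beta_i^j)_{1\le i\le n,\,1\le j\le N_\alpha}$ with nonnegative integer entries put $$(D\omega_\alpha)^\beta=\prod_{i=1}^n\prod_{j=1}^{N_\alpha}\left(\omega_i^{(j)}(t)\right)^{\beta_i^j} .$$ $\Sigma_\alpha$ denotes the set of all such $\beta$ satisfying: (1) if $\alpha_i=0$ for some $i$, then $\beta_i^j=0$ for all $j=1,\ldots,N_\alpha$; (2) $\sum_{j=1}^{N_\alpha}\beta_i^j=\alpha_i$ for each $i=1,\ldots,n$; (3) $\sigma(\beta):=\sum_{i=1}^n\sum_{j=1}^{N_\alpha}j\,\beta_i^j=d+1$. Write $\frac{d+1}{|\alpha|}=r+\gamma$ with $r$ an integer and $0\le\gamma<1$, and put $\kappa_\alpha=r$ if $\gamma=0$ and $\kappa_\alpha=r+1$ otherwise. *)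

theory Defs
  imports "HOL-Analysis.Analysis"
begin

section \<open>Smooth functions on the closed unit ball\<close>

definition dir_deriv :: "'a::euclidean_space \<Rightarrow> ('a \<Rightarrow> real) \<Rightarrow> 'a \<Rightarrow> real" where
  "dir_deriv b f x = deriv (\<lambda>h. f (x + h *\<^sub>R b)) 0"

primrec iter_partial :: "'a list \<Rightarrow> ('a::euclidean_space \<Rightarrow> real) \<Rightarrow> 'a \<Rightarrow> real" where
  "iter_partial [] f = f"
| "iter_partial (b # bs) f = dir_deriv b (iter_partial bs f)"

text \<open>
  A function on the closed unit ball is \<open>C\<^sup>k\<close> if all its iterated partial derivatives of order at
  most \<open>k\<close> exist in the open ball and extend continuously to the closed ball. For order 0 the
  extension has to be the given function itself. The values outside the closed ball are
  irrelevant. The case \<open>'a = real\<close>, with \<open>Basis = {1}\<close> and \<open>cball 0 1 = {-1..1}\<close>, covers functions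
  on the interval.
\<close>

definition smooth_on_ball :: "nat \<Rightarrow> ('a::euclidean_space \<Rightarrow> real) \<Rightarrow> bool" where
  "smooth_on_ball k f \<longleftrightarrow>
     continuous_on (cball 0 1) f \<and>
     (\<forall>bs b x. set bs \<subseteq> Basis \<and> length bs < k \<and> b \<in> Basis \<and> x \<in> ball 0 1 \<longrightarrow>
        (\<lambda>h. iter_partial bs f (x + h *\<^sub>R b)) field_differentiable at 0) \<and>
     (\<forall>bs. set bs \<subseteq> Basis \<and> length bs \<le> k \<longrightarrow>
        (\<exists>F. continuous_on (cball 0 1) F \<and> (\<forall>x\<in>ball 0 1. F x = iter_partial bs f x)))"

text \<open>The iterated partial derivative on the closed ball: at a boundary point, the value of the
  continuous extension.\<close>

definition ball_partial :: "'a list \<Rightarrow> ('a::euclidean_space \<Rightarrow> real) \<Rightarrow> 'a \<Rightarrow> real" where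
  "ball_partial bs f x =
     (if x \<in> ball 0 1 then iter_partial bs f x
      else Lim (at x within ball 0 1) (iter_partial bs f))"

definition interval_deriv :: "nat \<Rightarrow> (real \<Rightarrow> real) \<Rightarrow> real \<Rightarrow> real" where
  "interval_deriv k h t = ball_partial (replicate k 1) h t"

section \<open>Multi-indices\<close>

definition mi_abs :: "('n::finite \<Rightarrow> nat) \<Rightarrow> nat" where
  "mi_abs \<alpha> = (\<Sum>i\<in>UNIV. \<alpha> i)"

text \<open>The index type carries no order, so the order in which the \<open>\<alpha> i\<close> differentiations in each
  coordinate direction are carried out is chosen arbitrarily. For functions that are
  \<open>C\<^sup>k\<close> with \<open>k \<ge> mi_abs \<alpha>\<close> it is immaterial, by symmetry of the mixed partial derivatives.\<close>

definition mi_partial :: "('n::finite \<Rightarrow> nat) \<Rightarrow> (real^'n \<Rightarrow> real) \<Rightarrow> real^'n \<Rightarrow> real" where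
  "mi_partial \<alpha> f x =
     ball_partial (SOME bs. set bs \<subseteq> Basis \<and> (\<forall>i. count_list bs (axis i 1) = \<alpha> i)) f x"

definition alphas :: "nat \<Rightarrow> ('n::finite \<Rightarrow> nat) set" where
  "alphas d = {\<alpha>. 1 \<le> mi_abs \<alpha> \<and> mi_abs \<alpha> \<le> d + 1}"

definition N :: "nat \<Rightarrow> ('n::finite \<Rightarrow> nat) \<Rightarrow> nat" where
  "N d \<alpha> = d + 2 - mi_abs \<alpha>"

text \<open>The exponent \<open>\<beta>\<^sub>i\<^sup>j\<close>, for \<open>1 \<le> j \<le> N d \<alpha>\<close>, is \<open>\<beta> i j\<close>; as a total function, \<open>\<beta>\<close> vanishes
  for all other \<open>j\<close> (the first condition in the definition of \<open>Sigma_set\<close>).\<close>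

definition mono_deg :: "nat \<Rightarrow> ('n::finite \<Rightarrow> nat) \<Rightarrow> (nat \<Rightarrow> nat) \<Rightarrow> ('n \<Rightarrow> nat \<Rightarrow> nat) \<Rightarrow> nat" where
  \<comment> \<open>total degree of the monomial with exponents \<open>\<beta>\<close> when derivatives of order \<open>j\<close> have degree \<open>w j\<close>\<close>
  "mono_deg d \<alpha> w \<beta> = (\<Sum>i\<in>UNIV. \<Sum>j=1..N d \<alpha>. w j * \<beta> i j)"

definition Sigma_set :: "nat \<Rightarrow> ('n::finite \<Rightarrow> nat) \<Rightarrow> ('n \<Rightarrow> nat \<Rightarrow> nat) set" where
  "Sigma_set d \<alpha> = {\<beta>.
     (\<forall>i j. j \<notin> {1..N d \<alpha>} \<longrightarrow> \<beta> i j = 0) \<and>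
     (\<forall>i. \<alpha> i = 0 \<longrightarrow> (\<forall>j\<in>{1..N d \<alpha>}. \<beta> i j = 0)) \<and>
     (\<forall>i. (\<Sum>j=1..N d \<alpha>. \<beta> i j) = \<alpha> i) \<and>
     (\<Sum>i\<in>UNIV. \<Sum>j=1..N d \<alpha>. j * \<beta> i j) = d + 1}"

definition D_monomial ::
    "nat \<Rightarrow> ('n::finite \<Rightarrow> nat) \<Rightarrow> (real \<Rightarrow> real^'n) \<Rightarrow> real \<Rightarrow> ('n \<Rightarrow> nat \<Rightarrow> nat) \<Rightarrow> real" where
  "D_monomial d \<alpha> \<omega> t \<beta> =
     (\<Prod>i\<in>UNIV. \<Prod>j=1..N d \<alpha>. interval_deriv j (\<lambda>s. \<omega> s $ i) t ^ \<beta> i j)"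

definition kappa :: "nat \<Rightarrow> ('n::finite \<Rightarrow> nat) \<Rightarrow> nat" where
  "kappa d \<alpha> =
     (let q = real (d + 1) / real (mi_abs \<alpha>); r = nat \<lfloor>q\<rfloor>
      in if frac q = 0 then r else r + 1)"

text \<open>The index sets are finite, so that sums over them and their cardinalities are meaningful.\<close>

lemma finite_alphas: "finite (alphas d :: ('n::finite \<Rightarrow> nat) set)"
proof (rule finite_subset)
  show "alphas d \<subseteq> {f :: 'n \<Rightarrow> nat. \<forall>x. (x \<in> UNIV \<longrightarrow> f x \<in> {..d + 1}) \<and> (x \<notin> UNIV \<longrightarrow> f x = 0)}"
  proof
    fix \<alpha> :: "'n \<Rightarrow> nat" assume "\<alpha> \<in> alphas d"
    moreover have "\<alpha> i \<le> mi_abs \<alpha>" for i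
      unfolding mi_abs_def by (rule member_le_sum) auto
    ultimately show "\<alpha> \<in> {f. \<forall>x. (x \<in> UNIV \<longrightarrow> f x \<in> {..d + 1}) \<and> (x \<notin> UNIV \<longrightarrow> f x = 0)}"
      by (auto simp: alphas_def intro: order_trans)
  qed
  show "finite {f :: 'n \<Rightarrow> nat. \<forall>x. (x \<in> UNIV \<longrightarrow> f x \<in> {..d + 1}) \<and> (x \<notin> UNIV \<longrightarrow> f x = 0)}"
    by (rule finite_set_of_finite_funs) auto
qed

lemma finite_Sigma_set: "finite (Sigma_set d (\<alpha> :: 'n::finite \<Rightarrow> nat))"
proof -
  let ?R = "{r :: nat \<Rightarrow> nat. \<forall>j. (j \<in> {1..N d \<alpha>} \<longrightarrow> r j \<in> {..mi_abs \<alpha>}) \<and> (j \<notin> {1..N d \<alpha>} \<longrightarrow> r j = 0)}"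
  have "finite ?R" by (rule finite_set_of_finite_funs) auto
  then have "finite {\<beta> :: 'n \<Rightarrow> nat \<Rightarrow> nat. \<forall>i. (i \<in> UNIV \<longrightarrow> \<beta> i \<in> ?R) \<and> (i \<notin> UNIV \<longrightarrow> \<beta> i = (\<lambda>_. 0))}"
    by (intro finite_set_of_finite_funs) auto
  moreover have "\<beta> i j \<le> mi_abs \<alpha>" if "\<beta> \<in> Sigma_set d \<alpha>" "j \<in> {1..N d \<alpha>}" for \<beta> i j
  proof -
    have "\<beta> i j \<le> (\<Sum>j=1..N d \<alpha>. \<beta> i j)" using that(2) by (intro member_le_sum) auto
    also have "\<dots> = \<alpha> i" using that(1) by (simp add: Sigma_set_def)
    also have "\<dots> \<le> mi_abs \<alpha>" unfolding mi_abs_def by (rule member_le_sum) auto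
    finally show ?thesis .
  qed
  then have "Sigma_set d \<alpha> \<subseteq> {\<beta>. \<forall>i. (i \<in> UNIV \<longrightarrow> \<beta> i \<in> ?R) \<and> (i \<notin> UNIV \<longrightarrow> \<beta> i = (\<lambda>_. 0))}"
    by (auto simp: Sigma_set_def)
  ultimately show ?thesis by (rule finite_subset[rotated])
qed

lemma ex_partial_list:
  "\<exists>bs. set bs \<subseteq> Basis \<and> (\<forall>i. count_list bs (axis i 1 :: real^'n) = \<alpha> i)"
proof -
  obtain bs where bs: "mset bs = (\<Sum>i\<in>UNIV. replicate_mset (\<alpha> i) (axis i 1 :: real^'n))"
    using ex_mset by blast
  have "count_list bs (axis i 1) = \<alpha> i" for i
    by (simp add: count_mset[symmetric] bs count_sum axis_eq_axis if_distrib eq_commute cong: if_cong)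
  moreover have "set bs \<subseteq> Basis"
    unfolding set_mset_mset[symmetric] bs by (auto simp: set_mset_sum axis_in_Basis_iff split: if_splits)
  ultimately show ?thesis by blast
qed

end

theory Submission imports Defs begin

text \<open>
  At a boundary point of the ball the continuously extended partial derivatives still form a Frechet
  derivative relative to the closed ball (mean value inequality on the convex interior, then
  continuity), so the chain rule applies to curves touching the boundary, and induction on \<open>m\<close>
  writes the \<open>m\<close>-th derivative of \<open>f \<circ> \<omega>\<close> as a sum over lists of pairs \<open>(i, j)\<close>. Such a list
  stands for the product of the partial derivative of \<open>f\<close> along the \<open>i\<close>'s with the derivatives
  \<open>\<omega>\<^sub>i\<^sup>(\<^sup>j\<^sup>)\<close>. Differentiation either prepends a pair \<open>(i, 1)\<close> or raises one \<open>j\<close> by one. Every list with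
  all \<open>j \<ge> 1\<close> and \<open>\<Sum>j = d + 1\<close> arises in this way, so the coefficient of \<open>(\<alpha>, \<beta>)\<close>, the number of
  lists with these exponents, is positive. Hence all three bounds follow from counting the lists:
  a list of length at most \<open>m\<close> has at most \<open>n + m\<close> successors, which gives at most
  \<open>(n + d + 1)\<^sup>d\<^sup>+\<^sup>1\<close> lists.
\<close>

section \<open>Continuous partial derivatives\<close>

lemma has_real_derivative_along_line:
  fixes v :: "'a::real_normed_vector \<Rightarrow> real"
  assumes "((\<lambda>k. v (y + s *\<^sub>R a + k *\<^sub>R a)) has_real_derivative D) (at 0)"
  shows "((\<lambda>s. v (y + s *\<^sub>R a)) has_real_derivative D) (at s)"
proof -
  have "(\<lambda>k. v (y + s *\<^sub>R a + k *\<^sub>R a)) = (\<lambda>k. v (y + (s + k) *\<^sub>R a))"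
    by (simp add: scaleR_left_distrib add.assoc)
  then show ?thesis
    using assms DERIV_at_within_shift[of "\<lambda>k. v (y + k *\<^sub>R a)" D s 0 UNIV] by simp
qed

text \<open>Change the coordinates of \<open>y\<close> into those of \<open>z\<close> one at a time
  and use the mean value inequality on each edge. A box is used because replacing coordinates of one
  of its points by those of another never leaves it; \<open>B\<close> holds the coordinates still to
  be changed.\<close>

lemma box_partials_bound:
  fixes u :: "'a::euclidean_space \<Rightarrow> real"
  assumes U: "U = {y. \<forall>b\<in>Basis. \<bar>(y - x) \<bullet> b\<bar> < \<delta>}"
    and der: "\<And>y b. y \<in> U \<Longrightarrow> b \<in> Basis \<Longrightarrow> ((\<lambda>h. u (y + h *\<^sub>R b)) has_real_derivative p b y) (at 0)"
    and bound: "\<And>y b. y \<in> U \<Longrightarrow> b \<in> Basis \<Longrightarrow> \<bar>p b y\<bar> \<le> e"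
    and B: "finite B" "B \<subseteq> Basis"
    and yz: "y \<in> U" "z \<in> U" "\<And>b. b \<in> Basis - B \<Longrightarrow> y \<bullet> b = z \<bullet> b"
  shows "\<bar>u y - u z\<bar> \<le> e * (\<Sum>b\<in>B. \<bar>(y - z) \<bullet> b\<bar>)"
  using B yz
proof (induction B arbitrary: y rule: finite_induct)
  case empty
  then have "y = z" by (auto intro!: euclidean_eqI[where 'a = 'a])
  then show ?case by simp
next
  case (insert b B)
  \<comment> \<open>With this displacement \<open>y'\<close> has the \<open>b\<close>-coordinate of
    \<open>z\<close>, so the induction hypothesis for the smaller set applies to
    \<open>y'\<close>.\<close>
  define s where "s = (z - y) \<bullet> b"
  define y' where "y' = y + s *\<^sub>R b"
  have b: "b \<in> Basis" using insert by simp
  have line: "y + h *\<^sub>R b \<in> U" if h: "h \<in> closed_segment 0 s" for h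
  proof -
    have "\<bar>(y - x) \<bullet> b\<bar> < \<delta>" "\<bar>(z - x) \<bullet> b\<bar> < \<delta>" using insert.prems b by (auto simp: U)
    moreover have "(z - x) \<bullet> b = (y - x) \<bullet> b + s" by (simp add: s_def inner_diff_left)
    ultimately have 1: "\<bar>(y - x) \<bullet> b + h\<bar> < \<delta>"
      using h by (auto simp: closed_segment_eq_real_ivl split: if_splits)
    show ?thesis unfolding U
    proof (intro CollectI ballI)
      fix b' :: 'a assume b': "b' \<in> Basis"
      show "\<bar>(y + h *\<^sub>R b - x) \<bullet> b'\<bar> < \<delta>"
      proof (cases "b' = b")
        case True
        then show ?thesis using 1 b by (simp add: inner_simps algebra_simps)
      next
        case False
        then have "b \<bullet> b' = 0" using b b' by (simp add: inner_not_same_Basis)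
        then show ?thesis using insert.prems b' by (simp add: U inner_simps)
      qed
    qed
  qed
  have y': "y' \<in> U" using line[of s] by (simp add: y'_def)
  have "norm (u (y + s *\<^sub>R b) - u (y + 0 *\<^sub>R b)) \<le> e * norm (s - 0)"
  proof (rule field_differentiable_bound[where S = "closed_segment 0 s" and
        f = "\<lambda>h. u (y + h *\<^sub>R b)" and f' = "\<lambda>h. p b (y + h *\<^sub>R b)"])
    fix h assume h: "h \<in> closed_segment 0 s"
    have "((\<lambda>k. u (y + h *\<^sub>R b + k *\<^sub>R b)) has_real_derivative p b (y + h *\<^sub>R b)) (at 0)"
      using der line[OF h] b by blast
    then have "((\<lambda>k. u (y + k *\<^sub>R b)) has_real_derivative p b (y + h *\<^sub>R b)) (at h)"
      by (rule has_real_derivative_along_line)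
    then show "((\<lambda>h. u (y + h *\<^sub>R b)) has_real_derivative p b (y + h *\<^sub>R b)) (at h within closed_segment 0 s)"
      by (rule has_field_derivative_at_within)
    show "norm (p b (y + h *\<^sub>R b)) \<le> e" using bound line[OF h] b by simp
  qed auto
  then have 1: "\<bar>u y - u y'\<bar> \<le> e * \<bar>(y - z) \<bullet> b\<bar>"
    by (simp add: y'_def s_def abs_minus_commute inner_diff_left)
  have "\<bar>u y' - u z\<bar> \<le> e * (\<Sum>b\<in>B. \<bar>(y' - z) \<bullet> b\<bar>)"
  proof (rule insert.IH)
    fix b' assume b': "b' \<in> Basis - B"
    show "y' \<bullet> b' = z \<bullet> b'"
    proof (cases "b' = b")
      case True
      then show ?thesis using b by (simp add: y'_def s_def inner_simps)
    next
      case False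
      then show ?thesis using b b' insert.prems by (simp add: y'_def inner_simps inner_not_same_Basis)
    qed
  next
    show "B \<subseteq> Basis" using insert.prems(1) by simp
  qed (fact y' insert.prems(3))+
  also have "(\<Sum>b\<in>B. \<bar>(y' - z) \<bullet> b\<bar>) = (\<Sum>b\<in>B. \<bar>(y - z) \<bullet> b\<bar>)"
  proof (rule sum.cong)
    fix b' assume "b' \<in> B"
    then have "b' \<in> Basis" "b \<noteq> b'" using insert.hyps insert.prems by auto
    then have "b \<bullet> b' = 0" using b by (simp add: inner_not_same_Basis)
    then show "\<bar>(y' - z) \<bullet> b'\<bar> = \<bar>(y - z) \<bullet> b'\<bar>" by (simp add: y'_def inner_simps)
  qed simp
  finally show ?case using 1 insert.hyps by (simp add: distrib_left)
qed

text \<open>Subtracting the candidate linear map leaves a remainder \<open>w\<close> with partials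
  \<open>p b y - p b x\<close>. These are small near \<open>x\<close> by continuity, so
  \<open>box_partials_bound\<close> controls \<open>w y - w x\<close>.\<close>

lemma has_derivative_continuous_partials:
  fixes u :: "'a::euclidean_space \<Rightarrow> real"
  assumes S: "open S" "x \<in> S"
    and der: "\<And>y b. y \<in> S \<Longrightarrow> b \<in> Basis \<Longrightarrow> ((\<lambda>h. u (y + h *\<^sub>R b)) has_real_derivative p b y) (at 0)"
    and cont: "\<And>b. b \<in> Basis \<Longrightarrow> continuous_on S (p b)"
  shows "(u has_derivative (\<lambda>h. \<Sum>b\<in>Basis. p b x * (h \<bullet> b))) (at x)"
  unfolding has_derivative_within_alt
proof (intro conjI allI impI)
  show "bounded_linear (\<lambda>h. \<Sum>b\<in>Basis. p b x * (h \<bullet> b))"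
    by (intro bounded_linear_sum bounded_linear_const_mult bounded_linear_inner_left)
  fix e :: real assume "e > 0"
  define D where "D = real DIM('a)"
  have D: "D > 0" by (simp add: D_def)
  \<comment> \<open>Each of the \<open>D\<close> coordinates will contribute at most
    \<open>e / D\<close> times the norm, which adds up to \<open>e\<close>.\<close>
  have "\<forall>\<^sub>F y in nhds x. \<forall>b\<in>Basis. \<bar>p b y - p b x\<bar> < e / D"
  proof (rule eventually_ball_finite)
    show "\<forall>b\<in>Basis. \<forall>\<^sub>F y in nhds x. \<bar>p b y - p b x\<bar> < e / D"
    proof
      fix b :: 'a assume "b \<in> Basis"
      then have "isCont (p b) x" using cont S by (simp add: continuous_on_eq_continuous_at)
      then have "(p b \<longlongrightarrow> p b x) (nhds x)"
        by (simp add: isCont_def tendsto_at_iff_tendsto_nhds)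
      then show "\<forall>\<^sub>F y in nhds x. \<bar>p b y - p b x\<bar> < e / D"
        using tendstoD[of "p b" "p b x" "nhds x" "e / D"] \<open>e > 0\<close> D by (simp add: dist_real_def)
    qed
  qed simp
  then have "\<forall>\<^sub>F y in nhds x. y \<in> S \<and> (\<forall>b\<in>Basis. \<bar>p b y - p b x\<bar> < e / D)"
    using S by (intro eventually_conj) (auto simp: eventually_nhds)
  then obtain \<rho> where \<rho>: "\<rho> > 0" "\<And>y. dist y x < \<rho> \<Longrightarrow> y \<in> S"
    "\<And>y b. dist y x < \<rho> \<Longrightarrow> b \<in> Basis \<Longrightarrow> \<bar>p b y - p b x\<bar> < e / D"
    unfolding eventually_nhds_metric by blast
  \<comment> \<open>The Euclidean norm is at most the sum of the \<open>D\<close> coordinate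
    lengths, so a box of half-width \<open>\<rho> / D\<close> fits into the ball of radius
    \<open>\<rho>\<close>.\<close>
  define \<delta> where "\<delta> = \<rho> / D"
  define U where "U = {y. \<forall>b\<in>Basis. \<bar>(y - x) \<bullet> b\<bar> < \<delta>}"
  have U_dist: "dist y x < \<rho>" if "y \<in> U" for y
  proof -
    have "norm (y - x) \<le> (\<Sum>b\<in>Basis. \<bar>(y - x) \<bullet> b\<bar>)" by (rule norm_le_l1)
    also have "\<dots> < (\<Sum>b\<in>(Basis::'a set). \<delta>)" using that by (intro sum_strict_mono) (auto simp: U_def)
    also have "\<dots> = \<rho>" using D by (simp add: \<delta>_def D_def)
    finally show ?thesis by (simp add: dist_norm)
  qed
  define w where "w y = u y - (\<Sum>b\<in>Basis. p b x * (y \<bullet> b))" for y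
  have "\<delta> > 0" using \<rho> D by (simp add: \<delta>_def)
  show "\<exists>d>0. \<forall>y\<in>UNIV. norm (y - x) < d \<longrightarrow>
          norm (u y - u x - (\<Sum>b\<in>Basis. p b x * ((y - x) \<bullet> b))) \<le> e * norm (y - x)"
  proof (intro exI[of _ \<delta>] conjI ballI impI \<open>\<delta> > 0\<close>)
    fix y assume y: "norm (y - x) < \<delta>"
    have "\<bar>w y - w x\<bar> \<le> e / D * (\<Sum>b\<in>Basis. \<bar>(y - x) \<bullet> b\<bar>)"
    proof (rule box_partials_bound[where U = U and x = x and \<delta> = \<delta> and p = "\<lambda>b y. p b y - p b x"])
      fix z b assume z: "z \<in> U" and b: "b \<in> (Basis :: 'a set)"
      have eq: "(\<Sum>b'\<in>Basis. p b' x * ((z + h *\<^sub>R b) \<bullet> b')) = (\<Sum>b'\<in>Basis. p b' x * (z \<bullet> b')) + h * p b x" for h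
      proof -
        have "(\<Sum>b'\<in>Basis. p b' x * ((z + h *\<^sub>R b) \<bullet> b')) =
              (\<Sum>b'\<in>Basis. p b' x * (z \<bullet> b') + (if b' = b then h * p b x else 0))"
          using b by (intro sum.cong) (auto simp: inner_simps inner_not_same_Basis algebra_simps)
        then show ?thesis using b by (simp add: sum.distrib)
      qed
      show "((\<lambda>h. w (z + h *\<^sub>R b)) has_real_derivative p b z - p b x) (at 0)"
        unfolding w_def eq
        by (rule derivative_eq_intros der[OF \<rho>(2)[OF U_dist[OF z]] b] refl | simp)+
      show "\<bar>p b z - p b x\<bar> \<le> e / D" using \<rho>(3)[OF U_dist[OF z] b] by simp
    next
      show "y \<in> U" unfolding U_def using y Basis_le_norm[of _ "y - x"] by (auto intro: le_less_trans)
      show "x \<in> U" using \<open>\<delta> > 0\<close> by (simp add: U_def)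
    qed (auto simp: U_def)
    also have "\<dots> \<le> e / D * (\<Sum>b\<in>(Basis::'a set). norm (y - x))"
      using \<open>e > 0\<close> D by (intro mult_left_mono sum_mono Basis_le_norm) auto
    also have "\<dots> = e * norm (y - x)" using D by (simp add: D_def)
    finally show "norm (u y - u x - (\<Sum>b\<in>Basis. p b x * ((y - x) \<bullet> b))) \<le> e * norm (y - x)"
      by (simp add: w_def inner_diff_left right_diff_distrib sum_subtractf algebra_simps)
  qed
qed

lemma has_derivative_closure_continuous_partials:
  fixes u :: "'a::euclidean_space \<Rightarrow> real"
  assumes S: "open S" "convex S" "x \<in> closure S"
    and u: "continuous_on (closure S) u"
    and der: "\<And>y b. y \<in> S \<Longrightarrow> b \<in> Basis \<Longrightarrow> ((\<lambda>h. u (y + h *\<^sub>R b)) has_real_derivative p b y) (at 0)"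
    and cont: "\<And>b. b \<in> Basis \<Longrightarrow> continuous_on (closure S) (p b)"
  shows "(u has_derivative (\<lambda>h. \<Sum>b\<in>Basis. p b x * (h \<bullet> b))) (at x within closure S)"
  unfolding has_derivative_within_alt
proof (intro conjI allI impI)
  show "bounded_linear (\<lambda>h. \<Sum>b\<in>Basis. p b x * (h \<bullet> b))"
    by (intro bounded_linear_sum bounded_linear_const_mult bounded_linear_inner_left)
  fix e :: real assume "e > 0"
  define D where "D = real DIM('a)"
  have D: "D > 0" by (simp add: D_def)
  have "\<exists>\<delta>>0. \<forall>b\<in>Basis. \<forall>y\<in>closure S. dist y x < \<delta> \<longrightarrow> \<bar>p b y - p b x\<bar> < e / D"
  proof -
    have "\<exists>\<delta>>0. \<forall>y\<in>closure S. dist y x < \<delta> \<longrightarrow> \<bar>p b y - p b x\<bar> < e / D" if "b \<in> Basis" for b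
      using cont[OF that] S(3) \<open>e > 0\<close> D unfolding continuous_on_iff dist_real_def by simp
    then obtain \<delta> where \<delta>: "\<And>b. b \<in> Basis \<Longrightarrow> \<delta> b > 0"
      "\<And>b y. b \<in> Basis \<Longrightarrow> y \<in> closure S \<Longrightarrow> dist y x < \<delta> b \<Longrightarrow> \<bar>p b y - p b x\<bar> < e / D"
      by metis
    then show ?thesis
      by (intro exI[of _ "Min (\<delta> ` Basis)"]) auto
  qed
  then obtain \<delta> where \<delta>: "\<delta> > 0"
    "\<And>b y. b \<in> Basis \<Longrightarrow> y \<in> closure S \<Longrightarrow> dist y x < \<delta> \<Longrightarrow> \<bar>p b y - p b x\<bar> < e / D"
    by blast
  define w where "w y = u y - (\<Sum>b\<in>Basis. p b x * (y \<bullet> b))" for y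
  \<comment> \<open>Cutting with a ball preserves convexity, which the mean value inequality needs,
    and keeps the partials within \<open>e / D\<close> of those at \<open>x\<close>.\<close>
  define T where "T = ball x \<delta> \<inter> S"
  have T: "convex T" "T \<subseteq> S" using S by (auto simp: T_def convex_Int)
  then have clT: "closure T \<subseteq> closure S" by (simp add: closure_mono)
  have w: "continuous_on (closure T) w"
    unfolding w_def by (intro continuous_intros continuous_on_subset[OF u clT])
  have Lip: "\<bar>w y - w z\<bar> \<le> e * norm (y - z)" if yz: "y \<in> T" "z \<in> T" for y z
  proof -
    have "norm (w y - w z) \<le> e * norm (y - z)"
    proof (rule differentiable_bound[OF T(1) _ _ yz])
      fix y assume y: "y \<in> T"
      have "y \<in> S" using y by (simp add: T_def)
      have "(u has_derivative (\<lambda>h. \<Sum>b\<in>Basis. p b y * (h \<bullet> b))) (at y)"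
        by (rule has_derivative_continuous_partials[OF \<open>open S\<close> \<open>y \<in> S\<close> der])
          (use cont closure_subset in \<open>auto intro: continuous_on_subset\<close>)
      then have "(w has_derivative (\<lambda>h. (\<Sum>b\<in>Basis. p b y * (h \<bullet> b)) - (\<Sum>b\<in>Basis. p b x * (h \<bullet> b)))) (at y)"
        unfolding w_def by (auto intro!: derivative_eq_intros)
      then show "(w has_derivative (\<lambda>h. (\<Sum>b\<in>Basis. p b y * (h \<bullet> b)) - (\<Sum>b\<in>Basis. p b x * (h \<bullet> b)))) (at y within T)"
        by (rule has_derivative_at_withinI)
      show "onorm (\<lambda>h. (\<Sum>b\<in>Basis. p b y * (h \<bullet> b)) - (\<Sum>b\<in>Basis. p b x * (h \<bullet> b))) \<le> e"
      proof (rule onorm_le)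
        fix h
        have "norm ((\<Sum>b\<in>Basis. p b y * (h \<bullet> b)) - (\<Sum>b\<in>Basis. p b x * (h \<bullet> b)))
              = \<bar>\<Sum>b\<in>Basis. (p b y - p b x) * (h \<bullet> b)\<bar>"
          by (simp add: sum_subtractf left_diff_distrib)
        also have "\<dots> \<le> (\<Sum>b\<in>Basis. \<bar>(p b y - p b x) * (h \<bullet> b)\<bar>)" by (rule sum_abs)
        also have "\<dots> \<le> (\<Sum>b\<in>(Basis::'a set). e / D * norm h)"
        proof (rule sum_mono)
          fix b :: 'a assume b: "b \<in> Basis"
          have "y \<in> closure S" "dist y x < \<delta>"
            using y closure_subset by (auto simp: T_def dist_commute)
          then have "\<bar>p b y - p b x\<bar> \<le> e / D" using \<delta>(2) b by fastforce
          then show "\<bar>(p b y - p b x) * (h \<bullet> b)\<bar> \<le> e / D * norm h"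
            unfolding abs_mult using b by (intro mult_mono Basis_le_norm) auto
        qed
        also have "\<dots> = e * norm h" using D by (simp add: D_def)
        finally show "norm ((\<Sum>b\<in>Basis. p b y * (h \<bullet> b)) - (\<Sum>b\<in>Basis. p b x * (h \<bullet> b))) \<le> e * norm h" .
      qed
    qed
    then show ?thesis by simp
  qed
  \<comment> \<open>Both sides are continuous in each argument, so the bound passes to the closure
    one argument at a time.\<close>
  have Lip1: "\<bar>w y - w z\<bar> \<le> e * norm (y - z)" if y: "y \<in> closure T" and z: "z \<in> T" for y z
  proof -
    have "\<bar>w y - w z\<bar> - e * norm (y - z) \<le> 0"
      by (rule continuous_le_on_closure[OF _ y]) (use Lip z in \<open>auto intro!: continuous_intros w\<close>)
    then show ?thesis by simp
  qed
  have Lip2: "\<bar>w y - w z\<bar> \<le> e * norm (y - z)" if y: "y \<in> closure T" and z: "z \<in> closure T" for y z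
  proof -
    have "\<bar>w y - w z\<bar> - e * norm (y - z) \<le> 0"
      by (rule continuous_le_on_closure[OF _ z]) (use Lip1[OF y]  in \<open>auto intro!: continuous_intros w\<close>)
    then show ?thesis by simp
  qed
  \<comment> \<open>The ball is open, so a point of \<open>closure S\<close> inside it is a limit of
    points of \<open>T\<close>.\<close>
  have inT: "y \<in> closure T" if "y \<in> closure S" "norm (y - x) < \<delta>" for y
    using open_Int_closure_subset[of "ball x \<delta>" S] that by (auto simp: T_def dist_norm norm_minus_commute)
  show "\<exists>d>0. \<forall>y\<in>closure S. norm (y - x) < d \<longrightarrow>
          norm (u y - u x - (\<Sum>b\<in>Basis. p b x * ((y - x) \<bullet> b))) \<le> e * norm (y - x)"
  proof (intro exI[of _ \<delta>] conjI ballI impI \<open>\<delta> > 0\<close>)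
    fix y assume "y \<in> closure S" "norm (y - x) < \<delta>"
    then have "\<bar>w y - w x\<bar> \<le> e * norm (y - x)"
      using inT[of x] S(3) \<open>\<delta> > 0\<close> by (intro Lip2 inT) auto
    then show "norm (u y - u x - (\<Sum>b\<in>Basis. p b x * ((y - x) \<bullet> b))) \<le> e * norm (y - x)"
      by (simp add: w_def inner_diff_left right_diff_distrib sum_subtractf algebra_simps)
  qed
qed

section \<open>Symmetry of mixed second partials\<close>

text \<open>The mean value theorem is applied along \<open>b\<close> to the difference in direction
  \<open>c\<close>, and then along \<open>c\<close> to \<open>ub\<close>. Only one order of
  differentiation enters, so the lemma can be used again with \<open>b\<close> and \<open>c\<close>
  exchanged.\<close>

lemma second_difference_mvt:
  fixes u :: "'a::real_normed_vector \<Rightarrow> real"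
  assumes "h > 0"
    and S: "\<And>s r. s \<in> {0..h} \<Longrightarrow> r \<in> {0..h} \<Longrightarrow> x + s *\<^sub>R b + r *\<^sub>R c \<in> S"
    and ub: "\<And>y. y \<in> S \<Longrightarrow> ((\<lambda>h. u (y + h *\<^sub>R b)) has_real_derivative ub y) (at 0)"
    and ucb: "\<And>y. y \<in> S \<Longrightarrow> ((\<lambda>h. ub (y + h *\<^sub>R c)) has_real_derivative ucb y) (at 0)"
  shows "\<exists>s\<in>{0..h}. \<exists>r\<in>{0..h}.
    u (x + h *\<^sub>R b + h *\<^sub>R c) - u (x + h *\<^sub>R b) - u (x + h *\<^sub>R c) + u x = h * h * ucb (x + s *\<^sub>R b + r *\<^sub>R c)"
proof -
  define \<phi> where "\<phi> s = u (x + h *\<^sub>R c + s *\<^sub>R b) - u (x + s *\<^sub>R b)" for s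
  have "\<exists>s>0. s < h \<and> \<phi> h - \<phi> 0 = (h - 0) * (ub (x + s *\<^sub>R b + h *\<^sub>R c) - ub (x + s *\<^sub>R b))"
  proof (rule MVT2[OF \<open>h > 0\<close>])
    fix s assume s: "0 \<le> s" "s \<le> h"
    have "x + s *\<^sub>R b \<in> S" "x + h *\<^sub>R c + s *\<^sub>R b \<in> S"
      using S[of s 0] S[of s h] s \<open>h > 0\<close> by (auto simp: algebra_simps)
    then show "(\<phi> has_real_derivative ub (x + s *\<^sub>R b + h *\<^sub>R c) - ub (x + s *\<^sub>R b)) (at s)"
      unfolding \<phi>_def
      using DERIV_diff[OF has_real_derivative_along_line has_real_derivative_along_line, OF ub ub, of "x + h *\<^sub>R c" s x]
      by (simp add: add_ac)
  qed
  then obtain s where s: "0 < s" "s < h" "\<phi> h - \<phi> 0 = h * (ub (x + s *\<^sub>R b + h *\<^sub>R c) - ub (x + s *\<^sub>R b))"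
    by auto
  have "\<exists>r>0. r < h \<and> ub (x + s *\<^sub>R b + h *\<^sub>R c) - ub (x + s *\<^sub>R b + 0 *\<^sub>R c) = (h - 0) * ucb (x + s *\<^sub>R b + r *\<^sub>R c)"
    by (rule MVT2[OF \<open>h > 0\<close>]) (use s S in \<open>auto intro!: has_real_derivative_along_line ucb\<close>)
  then obtain r where r: "0 < r" "r < h" "ub (x + s *\<^sub>R b + h *\<^sub>R c) - ub (x + s *\<^sub>R b) = h * ucb (x + s *\<^sub>R b + r *\<^sub>R c)"
    by auto
  show ?thesis
    using s r by (intro bexI[of _ s] bexI[of _ r]) (auto simp: \<phi>_def algebra_simps)
qed

text \<open>The second difference is symmetric in \<open>b\<close> and \<open>c\<close>. Hence
  \<open>ucb\<close> and \<open>ubc\<close> take a common value at two, possibly different, points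
  arbitrarily close to \<open>x\<close>, and continuity at \<open>x\<close> forces equality
  there.\<close>

lemma symmetric_mixed_partials:
  fixes u :: "'a::real_normed_vector \<Rightarrow> real"
  assumes S: "open S" "x \<in> S"
    and ub: "\<And>y. y \<in> S \<Longrightarrow> ((\<lambda>h. u (y + h *\<^sub>R b)) has_real_derivative ub y) (at 0)"
    and uc: "\<And>y. y \<in> S \<Longrightarrow> ((\<lambda>h. u (y + h *\<^sub>R c)) has_real_derivative uc y) (at 0)"
    and ucb: "\<And>y. y \<in> S \<Longrightarrow> ((\<lambda>h. ub (y + h *\<^sub>R c)) has_real_derivative ucb y) (at 0)"
    and ubc: "\<And>y. y \<in> S \<Longrightarrow> ((\<lambda>h. uc (y + h *\<^sub>R b)) has_real_derivative ubc y) (at 0)"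
    and cont: "continuous_on S ucb" "continuous_on S ubc"
  shows "ucb x = ubc x"
proof (rule ccontr)
  assume ne: "ucb x \<noteq> ubc x"
  \<comment> \<open>Half the gap: two errors smaller than \<open>e\<close> cannot bridge it.\<close>
  define e where "e = \<bar>ucb x - ubc x\<bar> / 2"
  have "e > 0" using ne by (simp add: e_def)
  have "isCont ucb x" "isCont ubc x" using cont S by (simp_all add: continuous_on_eq_continuous_at)
  then obtain d1 d2 where d: "d1 > 0" "d2 > 0" "\<And>y. dist y x < d1 \<Longrightarrow> \<bar>ucb y - ucb x\<bar> < e"
     "\<And>y. dist y x < d2 \<Longrightarrow> \<bar>ubc y - ubc x\<bar> < e"
    using \<open>e > 0\<close> unfolding continuous_at_eps_delta dist_real_def by metis
  obtain d3 where d3: "d3 > 0" "ball x d3 \<subseteq> S" using S open_contains_ball by blast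
  define \<rho> where "\<rho> = min d1 (min d2 d3)"
  have \<rho>: "\<rho> > 0" using d d3 by (simp add: \<rho>_def)
  \<comment> \<open>With \<open>h = \<rho> / K\<close> the whole parallelogram stays closer to
    \<open>x\<close> than \<open>\<rho>\<close>. The summand 1 makes this strict and keeps
    \<open>K\<close> positive even if both directions vanish.\<close>
  define K where "K = norm b + norm c + 1"
  have K: "K > 0" by (simp add: K_def add_nonneg_pos)
  define h where "h = \<rho> / K"
  have h: "h > 0" using \<rho> K by (simp add: h_def)
  have near: "dist (x + s *\<^sub>R b + r *\<^sub>R c) x < \<rho>" if "s \<in> {0..h}" "r \<in> {0..h}" for s r
  proof -
    have "dist (x + s *\<^sub>R b + r *\<^sub>R c) x = norm (s *\<^sub>R b + r *\<^sub>R c)" by (simp add: dist_norm)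
    also have "\<dots> \<le> s * norm b + r * norm c"
      using that by (intro order_trans[OF norm_triangle_ineq]) auto
    also have "\<dots> \<le> h * norm b + h * norm c"
      using that by (intro add_mono mult_right_mono) auto
    also have "\<dots> < h * K" using h by (simp add: K_def distrib_left)
    also have "\<dots> = \<rho>" using K by (simp add: h_def)
    finally show ?thesis .
  qed
  have inS: "x + s *\<^sub>R b + r *\<^sub>R c \<in> S" if "s \<in> {0..h}" "r \<in> {0..h}" for s r
    using near[OF that] d3(2) by (auto simp: \<rho>_def dist_commute)
  obtain s r where 1: "s \<in> {0..h}" "r \<in> {0..h}"
    "u (x + h *\<^sub>R b + h *\<^sub>R c) - u (x + h *\<^sub>R b) - u (x + h *\<^sub>R c) + u x = h * h * ucb (x + s *\<^sub>R b + r *\<^sub>R c)"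
    using second_difference_mvt[OF h inS ub ucb] by blast
  have inS': "x + s *\<^sub>R c + r *\<^sub>R b \<in> S" if "s \<in> {0..h}" "r \<in> {0..h}" for s r
    using inS[OF that(2,1)] by (simp add: add_ac)
  obtain s' r' where 2: "s' \<in> {0..h}" "r' \<in> {0..h}"
    "u (x + h *\<^sub>R c + h *\<^sub>R b) - u (x + h *\<^sub>R c) - u (x + h *\<^sub>R b) + u x = h * h * ubc (x + s' *\<^sub>R c + r' *\<^sub>R b)"
    using second_difference_mvt[OF h inS' uc ubc] by blast
  have "x + s' *\<^sub>R c + r' *\<^sub>R b = x + r' *\<^sub>R b + s' *\<^sub>R c" by simp
  then have "dist (x + s' *\<^sub>R c + r' *\<^sub>R b) x < \<rho>" using near[OF 2(2,1)] by (rule ssubst)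
  then have "\<bar>ubc (x + s' *\<^sub>R c + r' *\<^sub>R b) - ubc x\<bar> < e" by (intro d) (simp add: \<rho>_def)
  moreover have "\<bar>ucb (x + s *\<^sub>R b + r *\<^sub>R c) - ucb x\<bar> < e"
    using near[OF 1(1,2)] d(3) by (simp add: \<rho>_def)
  moreover have "u (x + h *\<^sub>R c + h *\<^sub>R b) = u (x + h *\<^sub>R b + h *\<^sub>R c)" by (simp add: add_ac)
  then have "h * h * ubc (x + s' *\<^sub>R c + r' *\<^sub>R b) = h * h * ucb (x + s *\<^sub>R b + r *\<^sub>R c)"
    using 1 2 by linarith
  then have "ubc (x + s' *\<^sub>R c + r' *\<^sub>R b) = ucb (x + s *\<^sub>R b + r *\<^sub>R c)"
    using h by simp
  ultimately have "\<bar>ucb x - ubc x\<bar> < e + e" by arith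
  then show False by (simp add: e_def)
qed

section \<open>Smooth functions on the closed ball\<close>

lemma ball_partial_ball: "x \<in> ball 0 1 \<Longrightarrow> ball_partial bs f x = iter_partial bs f x"
  by (simp add: ball_partial_def)

text \<open>Every point of the closed ball is a limit point of the open ball, so the limit along the
  interior is unique and \<open>Lim\<close> returns the value of any continuous extension.\<close>

lemma ball_partial_eq_extension:
  assumes F: "continuous_on (cball 0 1) F" "\<And>y. y \<in> ball 0 1 \<Longrightarrow> F y = iter_partial bs f y"
    and x: "x \<in> cball 0 1"
  shows "ball_partial bs f x = F x"
proof (cases "x \<in> ball 0 1")
  case True
  then show ?thesis using F(2) by (simp add: ball_partial_ball)
next
  case False
  have "(F \<longlongrightarrow> F x) (at x within cball 0 1)" using F(1) x by (simp add: continuous_on_def)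
  then have "(F \<longlongrightarrow> F x) (at x within ball 0 1)"
    by (rule tendsto_within_subset) (rule ball_subset_cball)
  then have "(iter_partial bs f \<longlongrightarrow> F x) (at x within ball 0 1)"
    by (rule Lim_transform_eventually) (use F(2) in \<open>auto simp: eventually_at_filter\<close>)
  moreover have "at x within ball 0 1 \<noteq> bot"
    using x islimpt_ball[of x 0 1] by (simp add: trivial_limit_within)
  ultimately show ?thesis using False by (simp add: ball_partial_def tendsto_Lim)
qed

context
  fixes k :: nat and f :: "'a::euclidean_space \<Rightarrow> real"
  assumes smooth: "smooth_on_ball k f"
begin

lemma continuous_on_ball_partial:
  assumes "set bs \<subseteq> Basis" "length bs \<le> k"
  shows "continuous_on (cball 0 1) (ball_partial bs f)"
proof -
  obtain F where F: "continuous_on (cball 0 1) F" "\<And>y. y \<in> ball 0 1 \<Longrightarrow> F y = iter_partial bs f y"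
    using smooth assms unfolding smooth_on_ball_def by metis
  have "ball_partial bs f x = F x" if "x \<in> cball 0 1" for x
    by (rule ball_partial_eq_extension[OF F that])
  then show ?thesis using continuous_on_eq[OF F(1)] by simp
qed

lemma continuous_on_iter_partial:
  assumes "set bs \<subseteq> Basis" "length bs \<le> k"
  shows "continuous_on (ball 0 1) (iter_partial bs f)"
proof -
  have "continuous_on (ball 0 1) (ball_partial bs f)"
    by (rule continuous_on_subset[OF continuous_on_ball_partial[OF assms] ball_subset_cball])
  then show ?thesis by (rule continuous_on_eq) (rule ball_partial_ball)
qed

lemma ball_partial_Nil: "x \<in> cball 0 1 \<Longrightarrow> ball_partial [] f x = f x"
  using smooth by (intro ball_partial_eq_extension) (auto simp: smooth_on_ball_def)

lemma iter_partial_has_derivative: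
  assumes "set bs \<subseteq> Basis" "length bs < k" "b \<in> Basis" "x \<in> ball 0 1"
  shows "((\<lambda>h. iter_partial bs f (x + h *\<^sub>R b)) has_real_derivative iter_partial (b # bs) f x) (at 0)"
proof -
  have "(\<lambda>h. iter_partial bs f (x + h *\<^sub>R b)) field_differentiable at 0"
    using smooth assms unfolding smooth_on_ball_def by blast
  then show ?thesis
    by (simp add: DERIV_deriv_iff_field_differentiable[symmetric] dir_deriv_def)
qed

lemma ball_partial_has_directional_derivative:
  assumes "set bs \<subseteq> Basis" "length bs < k" "b \<in> Basis" "x \<in> ball 0 1"
  shows "((\<lambda>h. ball_partial bs f (x + h *\<^sub>R b)) has_real_derivative ball_partial (b # bs) f x) (at 0)"
proof -
  let ?H = "(\<lambda>h. x + h *\<^sub>R b) -` ball 0 1"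
  have "open ?H" by (intro open_vimage continuous_intros) simp
  moreover have "0 \<in> ?H" using assms by simp
  ultimately have "((\<lambda>h. ball_partial bs f (x + h *\<^sub>R b)) has_real_derivative iter_partial (b # bs) f x) (at 0)"
    by (rule has_field_derivative_transform_within_open[OF iter_partial_has_derivative[OF assms]])
      (simp add: ball_partial_def)
  then show ?thesis using assms by (simp add: ball_partial_ball)
qed

lemma ball_partial_has_derivative:
  assumes "set bs \<subseteq> Basis" "length bs < k" "x \<in> cball 0 1"
  shows "(ball_partial bs f has_derivative (\<lambda>h. \<Sum>b\<in>Basis. ball_partial (b # bs) f x * (h \<bullet> b)))
    (at x within cball 0 1)"
  using has_derivative_closure_continuous_partials[of "ball 0 1" x "ball_partial bs f" "\<lambda>b. ball_partial (b # bs) f"]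
    continuous_on_ball_partial ball_partial_has_directional_derivative assms
  by (simp add: less_imp_le)

lemma iter_partial_swap:
  assumes "set bs \<subseteq> Basis" "length bs + 2 \<le> k" "b \<in> Basis" "c \<in> Basis" "x \<in> ball 0 1"
  shows "iter_partial (c # b # bs) f x = iter_partial (b # c # bs) f x"
proof (rule symmetric_mixed_partials[where S = "ball 0 1" and b = b and c = c and u = "iter_partial bs f"
      and ub = "iter_partial (b # bs) f" and uc = "iter_partial (c # bs) f"])
  show "continuous_on (ball 0 1) (iter_partial (c # b # bs) f)"
    "continuous_on (ball 0 1) (iter_partial (b # c # bs) f)"
    using assms by (intro continuous_on_iter_partial; simp)+
qed (use assms in \<open>auto intro!: iter_partial_has_derivative simp del: iter_partial.simps\<close>)

end

section \<open>Independence of the order of differentiation\<close>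

text \<open>Agreement is known on the open ball only; this is enough because \<open>deriv\<close>
  depends only on values near the point.\<close>

lemma iter_partial_Cons_cong:
  assumes "\<And>y. y \<in> ball 0 1 \<Longrightarrow> iter_partial bs f y = iter_partial cs f y" "x \<in> ball 0 1"
  shows "iter_partial (b # bs) f x = iter_partial (b # cs) f x"
proof -
  let ?H = "(\<lambda>h. x + h *\<^sub>R b) -` ball 0 1"
  have "open ?H" by (intro open_vimage continuous_intros) simp
  moreover have "0 \<in> ?H" using assms by simp
  ultimately have "\<forall>\<^sub>F h in nhds 0. h \<in> ?H" by (rule eventually_nhds_in_open)
  then have "\<forall>\<^sub>F h in nhds 0. iter_partial bs f (x + h *\<^sub>R b) = iter_partial cs f (x + h *\<^sub>R b)"
    by eventually_elim (use assms in auto)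
  then show ?thesis by (simp add: dir_deriv_def deriv_cong_ev)
qed

text \<open>Adjacent swaps carry \<open>b\<close> to the front; a swap below outer derivatives is
  justified by \<open>iter_partial_Cons_cong\<close>.\<close>

lemma iter_partial_move_front:
  assumes "smooth_on_ball k f" "set (as @ b # bs) \<subseteq> Basis" "length (as @ b # bs) \<le> k" "x \<in> ball 0 1"
  shows "iter_partial (as @ b # bs) f x = iter_partial (b # as @ bs) f x"
  using assms(2-4)
proof (induction as arbitrary: x)
  case (Cons a as)
  have "iter_partial (a # as @ b # bs) f x = iter_partial (a # b # as @ bs) f x"
    using Cons.prems by (intro iter_partial_Cons_cong Cons.IH) auto
  also have "\<dots> = iter_partial (b # a # as @ bs) f x"
    using Cons.prems by (intro iter_partial_swap[OF assms(1)]) auto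
  finally show ?case by simp
qed simp

text \<open>Pull the head of \<open>as\<close> to the front of \<open>bs\<close>, cancel it, and
  apply induction to the remaining permutation.\<close>

lemma iter_partial_mset_eq:
  assumes "smooth_on_ball k f" "mset as = mset bs" "set as \<subseteq> Basis" "length as \<le> k" "x \<in> ball 0 1"
  shows "iter_partial as f x = iter_partial bs f x"
  using assms(2-5)
proof (induction as arbitrary: bs x)
  case (Cons a as)
  have "a \<in> set bs" using mset_eq_setD[OF Cons.prems(1)] by auto
  then obtain us vs where bs: "bs = us @ a # vs" by (meson split_list)
  have eq: "mset as = mset (us @ vs)" using Cons.prems by (simp add: bs)
  have len: "length bs = length (a # as)" "set bs = set (a # as)"
    using mset_eq_length[OF Cons.prems(1)] mset_eq_setD[OF Cons.prems(1)] by auto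
  have "iter_partial (a # as) f x = iter_partial (a # us @ vs) f x"
    using Cons.prems by (intro iter_partial_Cons_cong Cons.IH eq) auto
  also have "\<dots> = iter_partial bs f x"
    unfolding bs using Cons.prems len
    by (intro iter_partial_move_front[OF assms(1), symmetric]) (auto simp: bs)
  finally show ?case .
qed simp

lemma ball_partial_mset_eq:
  assumes "smooth_on_ball k f" "mset as = mset bs" "set as \<subseteq> Basis" "length as \<le> k" "x \<in> cball 0 1"
  shows "ball_partial as f x = ball_partial bs f x"
proof (rule ball_partial_eq_extension[OF _ _ assms(5)])
  show "continuous_on (cball 0 1) (ball_partial bs f)"
    using mset_eq_length[OF assms(2)] mset_eq_setD[OF assms(2)] assms
    by (intro continuous_on_ball_partial) auto
  show "ball_partial bs f y = iter_partial as f y" if "y \<in> ball 0 1" for y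
    using iter_partial_mset_eq[OF assms(1-4) that] that by (simp add: ball_partial_ball)
qed

lemma Basis_cart_eq_range: "(Basis :: (real^'n) set) = range (\<lambda>i. axis i 1)"
  by (auto simp: Basis_vec_def)

text \<open>Removes the arbitrary choice in \<open>mi_partial\<close>: lists of basis vectors with
  the same counts are permutations of each other, since all other vectors occur zero times in
  both.\<close>

lemma mi_partial_eq_ball_partial:
  fixes \<alpha> :: "'n::finite \<Rightarrow> nat"
  assumes "smooth_on_ball k f" "set bs \<subseteq> Basis" "length bs \<le> k" "x \<in> cball 0 1"
    and cnt: "\<And>i. count_list bs (axis i 1) = \<alpha> i"
  shows "mi_partial \<alpha> f x = ball_partial bs f x"
proof -
  define cs where "cs = (SOME bs. set bs \<subseteq> Basis \<and> (\<forall>i. count_list bs (axis i 1 :: real^'n) = \<alpha> i))"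
  have cs: "set cs \<subseteq> Basis" "count_list cs (axis i 1) = \<alpha> i" for i
    using someI_ex[OF ex_partial_list[of \<alpha>]] by (auto simp: cs_def)
  have "mset bs = mset cs"
  proof (rule multiset_eqI)
    fix b :: "real^'n"
    show "count (mset bs) b = count (mset cs) b"
    proof (cases "b \<in> Basis")
      case True
      then obtain i where "b = axis i 1" by (auto simp: Basis_cart_eq_range)
      then show ?thesis using cnt cs by (simp add: count_mset)
    next
      case False
      then have "b \<notin> set bs" "b \<notin> set cs" using cs(1) assms(2) by auto
      then show ?thesis by (simp add: count_mset)
    qed
  qed
  then have "ball_partial bs f x = ball_partial cs f x"
    using assms by (intro ball_partial_mset_eq)
  then show ?thesis by (simp add: mi_partial_def cs_def)
qed

section \<open>Functions on the interval\<close>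

lemma cball_real_eq: "cball (0::real) 1 = {-1..1}" "ball (0::real) 1 = {-1<..<1}"
  by (simp_all add: cball_eq_atLeastAtMost ball_eq_greaterThanLessThan)

lemma interval_deriv_0: "smooth_on_ball k h \<Longrightarrow> t \<in> {-1..1} \<Longrightarrow> interval_deriv 0 h t = h t"
  unfolding interval_deriv_def using ball_partial_Nil[of k h t] by (simp add: cball_real_eq)

lemma interval_deriv_has_derivative:
  assumes "smooth_on_ball k h" "j < k" "t \<in> {-1..1}"
  shows "(interval_deriv j h has_real_derivative interval_deriv (Suc j) h t) (at t within {-1..1})"
  using ball_partial_has_derivative[OF assms(1), of "replicate j 1" t] assms(2,3)
  by (simp add: interval_deriv_def[abs_def] has_field_derivative_def cball_real_eq set_replicate_conv_if)

lemma continuous_on_interval_deriv: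
  assumes "smooth_on_ball k h" "j \<le> k"
  shows "continuous_on {-1..1} (interval_deriv j h)"
  using continuous_on_ball_partial[OF assms(1), of "replicate j 1"] assms(2)
  by (simp add: interval_deriv_def[abs_def] cball_real_eq set_replicate_conv_if)

text \<open>At interior points the derivative within the interval is an ordinary one. An iterated
  derivative equal to \<open>S m\<close> on the open interval can therefore be differentiated like
  \<open>S m\<close>, which is the induction step.\<close>

lemma iter_partial_interval_family:
  assumes S0: "\<And>t. t \<in> {-1..1} \<Longrightarrow> S 0 t = g t"
    and der: "\<And>m t. m < k \<Longrightarrow> t \<in> {-1..1} \<Longrightarrow>
      (S m has_real_derivative S (Suc m) t) (at t within {-1..1})"
    and "m \<le> k" "t \<in> {-1<..<1::real}"
  shows "iter_partial (replicate m 1) g t = S m t"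
    and "m < k \<Longrightarrow> ((\<lambda>h. iter_partial (replicate m 1) g (t + h)) has_real_derivative S (Suc m) t) (at 0)"
proof -
  have step: "((\<lambda>h. u (t + h)) has_real_derivative S (Suc m) t) (at 0)"
    if u: "\<And>t. t \<in> {-1<..<1} \<Longrightarrow> u t = S m t" and m: "m < k" and t: "t \<in> {-1<..<1}" for u m t
  proof -
    have "(S m has_real_derivative S (Suc m) t) (at t)"
      using der[OF m, of t] t at_within_interior[of t "{-1..1}"] by simp
    then have "(u has_real_derivative S (Suc m) t) (at t)"
      by (rule has_field_derivative_transform_within_open[where S = "{-1<..<1}"]) (use u t in auto)
    then show ?thesis using DERIV_at_within_shift[of u "S (Suc m) t" t 0 UNIV] by simp
  qed
  have 1: "m \<le> k \<Longrightarrow> t \<in> {-1<..<1} \<Longrightarrow> iter_partial (replicate m 1) g t = S m t" for m t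
  proof (induction m arbitrary: t)
    case (Suc m)
    then show ?case
      using DERIV_imp_deriv[OF step[of "iter_partial (replicate m 1) g" m t]]
      by (simp add: dir_deriv_def)
  qed (simp add: S0)
  show "iter_partial (replicate m 1) g t = S m t" using 1 assms by simp
  show "m < k \<Longrightarrow> ((\<lambda>h. iter_partial (replicate m 1) g (t + h)) has_real_derivative S (Suc m) t) (at 0)"
    using 1 step assms by simp
qed

text \<open>A criterion that avoids unfolding the iterated derivatives of \<open>g\<close>: it
  suffices to exhibit candidates, each the derivative of the one before (one-sided at the end
  points), with a continuous last member.\<close>

lemma smooth_on_interval_family:
  assumes S0: "\<And>t. t \<in> {-1..1} \<Longrightarrow> S 0 t = g t"
    and der: "\<And>m t. m < k \<Longrightarrow> t \<in> {-1..1} \<Longrightarrow>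
      (S m has_real_derivative S (Suc m) t) (at t within {-1..1})"
    and cont: "continuous_on {-1..1::real} (S k)"
  shows "smooth_on_ball k g"
    and "m \<le> k \<Longrightarrow> t \<in> {-1..1} \<Longrightarrow> interval_deriv m g t = S m t"
proof -
  note iter = iter_partial_interval_family[where S = S and g = g and k = k, OF S0 der]
  have contS: "continuous_on {-1..1} (S m)" if "m \<le> k" for m
  proof (cases "m = k")
    case False
    then show ?thesis using der[of m, THEN DERIV_continuous] that
      by (simp add: continuous_on_eq_continuous_within)
  qed (simp add: cont)
  \<comment> \<open>The only basis vector of the real line is 1.\<close>
  have rep: "bs = replicate (length bs) 1" if "set bs \<subseteq> Basis" for bs :: "real list"
    using that by (intro replicate_eqI) auto
  show "smooth_on_ball k g"
    unfolding smooth_on_ball_def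
  proof (intro conjI allI impI; (elim conjE)?)
    show "continuous_on (cball 0 1) g"
      using continuous_on_eq[OF contS[of 0] S0] by (simp add: cball_real_eq)
    fix bs :: "real list" and b x :: real
    assume "set bs \<subseteq> Basis" "length bs < k" "b \<in> Basis" "x \<in> ball 0 1"
    then show "(\<lambda>h. iter_partial bs g (x + h *\<^sub>R b)) field_differentiable at 0"
      using iter(2)[of "length bs" x] rep[of bs] by (auto simp: cball_real_eq field_differentiable_def)
  next
    fix bs :: "real list"
    assume "set bs \<subseteq> Basis" "length bs \<le> k"
    then show "\<exists>F. continuous_on (cball 0 1) F \<and> (\<forall>x\<in>ball 0 1. F x = iter_partial bs g x)"
      using iter(1)[of "length bs"] rep[of bs] contS[of "length bs"]
      by (intro exI[of _ "S (length bs)"]) (auto simp: cball_real_eq)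
  qed
  show "interval_deriv m g t = S m t" if "m \<le> k" "t \<in> {-1..1}"
    unfolding interval_deriv_def
    by (rule ball_partial_eq_extension) (use that contS iter(1) in \<open>auto simp: cball_real_eq\<close>)
qed

section \<open>Terms of the iterated chain rule\<close>

fun raise_order :: "('n \<times> nat) list \<Rightarrow> ('n \<times> nat) list list" where
  "raise_order [] = []"
| "raise_order (p # l) = ((fst p, Suc (snd p)) # l) # map (Cons p) (raise_order l)"

text \<open>Lists rather than sets, because the multiplicity of a term becomes its coefficient.
  \<open>es\<close> enumerates the coordinates. A new pair \<open>(i, 1)\<close> comes from the
  chain rule on the factor of \<open>f\<close>, \<open>raise_order\<close> from the product rule on
  the curve factors.\<close>

primrec chain_terms :: "'n list \<Rightarrow> nat \<Rightarrow> ('n \<times> nat) list list" where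
  "chain_terms es 0 = [[]]"
| "chain_terms es (Suc m) =
     concat (map (\<lambda>l. map (\<lambda>i. (i, 1) # l) es @ raise_order l) (chain_terms es m))"

lemma length_raise_order: "length (raise_order l) = length l"
  by (induction l) auto

lemma map_fst_raise_order: "l' \<in> set (raise_order l) \<Longrightarrow> map fst l' = map fst l"
  by (induction l arbitrary: l') auto

lemma raise_order_pos_weight:
  assumes "l' \<in> set (raise_order l)" "\<And>p. p \<in> set l \<Longrightarrow> 1 \<le> snd p"
  shows "(\<forall>p\<in>set l'. 1 \<le> snd p) \<and> (\<Sum>p\<leftarrow>l'. snd p) = Suc (\<Sum>p\<leftarrow>l. snd p)"
  using assms by (induction l arbitrary: l') fastforce+

lemma chain_terms_pos_weight:
  "l \<in> set (chain_terms es m) \<Longrightarrow> (\<forall>p\<in>set l. 1 \<le> snd p) \<and> (\<Sum>p\<leftarrow>l. snd p) = m"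
proof (induction m arbitrary: l)
  case (Suc m)
  then obtain l0 where l0: "l0 \<in> set (chain_terms es m)"
    "(\<exists>i\<in>set es. l = (i, 1) # l0) \<or> l \<in> set (raise_order l0)" by auto
  note IH = Suc.IH[OF l0(1)]
  from l0(2) show ?case
  proof
    assume "l \<in> set (raise_order l0)"
    then show ?case using raise_order_pos_weight[of l l0] IH by auto
  qed (use IH in auto)
qed simp

text \<open>A list is rebuilt from its last entry: prepend \<open>(i, 1)\<close>, then raise only
  the head until it has the wanted order. Thus all orderings of the entries are generated.\<close>

lemma chain_terms_complete:
  assumes "set es = UNIV" "\<And>p. p \<in> set l \<Longrightarrow> 1 \<le> snd p"
  shows "l \<in> set (chain_terms es (\<Sum>p\<leftarrow>l. snd p))"
  using assms(2)
proof (induction l)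
  case (Cons p l)
  obtain i j where p: "p = (i, j)" by force
  have IH: "l \<in> set (chain_terms es (\<Sum>p\<leftarrow>l. snd p))" using Cons by simp
  \<comment> \<open>This \<open>j\<close> counts the raises of the head after \<open>(i, 1)\<close>
    was prepended, hence the shift by one against the order in \<open>p\<close>.\<close>
  have "(i, Suc j) # l \<in> set (chain_terms es (Suc j + (\<Sum>p\<leftarrow>l. snd p)))" for j
  proof (induction j)
    case 0
    then show ?case using IH assms(1) by force
  next
    case (Suc j)
    then show ?case by force
  qed
  moreover have "Suc (j - 1) = j" using Cons.prems[of p] by (simp add: p)
  ultimately have "(i, j) # l \<in> set (chain_terms es (j + (\<Sum>p\<leftarrow>l. snd p)))" by metis
  then show ?case by (simp add: p)
qed simp

lemma length_le_weight:
  assumes "\<And>p. p \<in> set l \<Longrightarrow> 1 \<le> (snd p :: nat)"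
  shows "length l \<le> (\<Sum>p\<leftarrow>l. snd p)"
  using assms
proof (induction l)
  case (Cons q l)
  then have "1 \<le> snd q" "length l \<le> (\<Sum>p\<leftarrow>l. snd p)" by simp_all
  then show ?case by simp
qed simp

text \<open>The other \<open>length l - 1\<close> entries have order at least one each. For weight
  \<open>d + 1\<close> this yields the cutoff
  \<open>N d \<alpha> = d + 2 - mi_abs \<alpha>\<close>.\<close>

lemma order_le_weight:
  assumes "\<And>p. p \<in> set l \<Longrightarrow> 1 \<le> (snd p :: nat)" "p \<in> set l"
  shows "snd p + length l \<le> Suc (\<Sum>p\<leftarrow>l. snd p)"
  using assms
proof (induction l)
  case (Cons q l)
  have "length l \<le> (\<Sum>p\<leftarrow>l. snd p)" "1 \<le> snd q"
    using length_le_weight[of l] Cons.prems(1) by simp_all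
  moreover have "p \<in> set l \<Longrightarrow> snd p + length l \<le> Suc (\<Sum>p\<leftarrow>l. snd p)" using Cons by simp
  ultimately show ?case using Cons.prems(2) by auto
qed simp

lemma length_chain_terms: "length (chain_terms es m) \<le> (length es + m) ^ m"
proof (induction m)
  case (Suc m)
  have "length (chain_terms es (Suc m)) = (\<Sum>l\<leftarrow>chain_terms es m. length es + length l)"
    by (simp add: length_concat comp_def length_raise_order)
  also have "\<dots> \<le> (\<Sum>l\<leftarrow>chain_terms es m. length es + m)"
    using chain_terms_pos_weight[of _ es m] length_le_weight
    by (intro sum_list_mono add_left_mono) force
  also have "\<dots> = (length es + m) * length (chain_terms es m)"
    by (simp add: sum_list_triv)
  also have "\<dots> \<le> (length es + m) * (length es + m) ^ m" using Suc by (rule mult_le_mono2)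
  also have "\<dots> \<le> (length es + Suc m) ^ Suc m"
    unfolding power_Suc[symmetric] by (rule power_mono) auto
  finally show ?case .
qed simp

section \<open>From terms to multi-indices and exponents\<close>

definition type_of_term :: "('n \<times> nat) list \<Rightarrow> 'n \<Rightarrow> nat" where
  "type_of_term l i = count_list (map fst l) i"

definition exponents_of_term :: "('n \<times> nat) list \<Rightarrow> 'n \<Rightarrow> nat \<Rightarrow> nat" where
  "exponents_of_term l i j = count_list l (i, j)"

lemma sum_list_eq_sum_count:
  fixes w :: "'b \<Rightarrow> nat"
  assumes "finite A" "set l \<subseteq> A"
  shows "(\<Sum>p\<leftarrow>l. w p) = (\<Sum>x\<in>A. w x * count_list l x)"
  using assms(2)
proof (induction l)
  case (Cons a l)
  have "(\<Sum>x\<in>A. w x * count_list (a # l) x) = (\<Sum>x\<in>A. w x * count_list l x + (if a = x then w x else 0))"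
    by (intro sum.cong) auto
  then show ?case using Cons assms(1) by (simp add: sum.distrib)
qed simp

lemma prod_list_eq_prod_count:
  fixes v :: "'b \<Rightarrow> real"
  assumes "finite A" "set l \<subseteq> A"
  shows "(\<Prod>p\<leftarrow>l. v p) = (\<Prod>x\<in>A. v x ^ count_list l x)"
  using assms(2)
proof (induction l)
  case (Cons a l)
  have "(\<Prod>x\<in>A. v x ^ count_list (a # l) x) = (\<Prod>x\<in>A. v x ^ count_list l x * (if a = x then v x else 1))"
    by (intro prod.cong) auto
  then show ?case using Cons assms(1) by (simp add: prod.distrib)
qed simp

lemma type_of_term_eq_sum_exponents:
  assumes "snd ` set l \<subseteq> J" "finite J"
  shows "type_of_term l i = (\<Sum>j\<in>J. exponents_of_term l i j)"
  using assms(1)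
proof (induction l)
  case (Cons p l)
  have "(\<Sum>j\<in>J. exponents_of_term (p # l) i j) =
      (\<Sum>j\<in>J. exponents_of_term l i j + (if snd p = j then if fst p = i then 1 else 0 else 0))"
    by (intro sum.cong) (auto simp: exponents_of_term_def)
  then show ?case using Cons assms(2) by (simp add: sum.distrib type_of_term_def)
qed (simp add: type_of_term_def exponents_of_term_def)

lemma mi_abs_type_of_term: "mi_abs (type_of_term l) = length l"
  unfolding mi_abs_def type_of_term_def using sum_count_set[of "map fst l" UNIV] by simp

lemma weight_eq_sum_exponents:
  fixes l :: "('n::finite \<times> nat) list"
  assumes "snd ` set l \<subseteq> J" "finite J"
  shows "(\<Sum>i\<in>UNIV. \<Sum>j\<in>J. j * exponents_of_term l i j) = (\<Sum>p\<leftarrow>l. snd p)"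
proof -
  have "set l \<subseteq> UNIV \<times> J" using assms(1) by force
  then show ?thesis
    using sum_list_eq_sum_count[of "UNIV \<times> J" l snd] assms(2)
    by (simp add: sum.cartesian_product exponents_of_term_def case_prod_beta)
qed

lemma chain_terms_order_le:
  assumes "l \<in> set (chain_terms es (d + 1))" "p \<in> set l"
  shows "snd p \<in> {1..N d (type_of_term l)}"
  using chain_terms_pos_weight[OF assms(1)] order_le_weight[of l p] assms(2)
  by (auto simp: N_def mi_abs_type_of_term)

lemma type_of_chain_term:
  fixes l :: "('n::finite \<times> nat) list"
  assumes l: "l \<in> set (chain_terms es (d + 1))"
  shows "type_of_term l \<in> alphas d" "exponents_of_term l \<in> Sigma_set d (type_of_term l)"
proof -
  note pw = chain_terms_pos_weight[OF l]
  have J: "snd ` set l \<subseteq> {1..N d (type_of_term l)}" using chain_terms_order_le[OF l] by auto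
  have "length l \<le> d + 1" using length_le_weight[of l] pw by auto
  \<comment> \<open>The empty list has weight 0, not \<open>d + 1\<close>; this gives the lower
    bound 1 on the order.\<close>
  moreover have "l \<noteq> []" using pw by auto
  ultimately show "type_of_term l \<in> alphas d"
    by (simp add: alphas_def mi_abs_type_of_term Suc_le_eq)
  have "exponents_of_term l i j = 0" if "j \<notin> {1..N d (type_of_term l)}" for i j
    using that J by (force simp: exponents_of_term_def count_list_0_iff)
  moreover have "(\<Sum>j = 1..N d (type_of_term l). exponents_of_term l i j) = type_of_term l i" for i
    using type_of_term_eq_sum_exponents[OF J] by simp
  moreover from this have "exponents_of_term l i j = 0"
    if "type_of_term l i = 0" "j \<in> {1..N d (type_of_term l)}" for i j
    using that by (metis finite_atLeastAtMost sum_eq_0_iff)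
  ultimately show "exponents_of_term l \<in> Sigma_set d (type_of_term l)"
    using weight_eq_sum_exponents[OF J] pw by (simp add: Sigma_set_def)
qed

text \<open>Write out \<open>\<beta>\<close> as a list of pairs with multiplicities, in any order.
  The conditions of \<open>Sigma_set\<close> give it positive orders and weight
  \<open>d + 1\<close>, so \<open>chain_terms_complete\<close> applies. This is what makes all
  coefficients nonzero.\<close>

lemma ex_chain_term:
  fixes \<alpha> :: "'n::finite \<Rightarrow> nat"
  assumes "set es = UNIV" "\<beta> \<in> Sigma_set d \<alpha>"
  shows "\<exists>l\<in>set (chain_terms es (d + 1)). type_of_term l = \<alpha> \<and> exponents_of_term l = \<beta>"
proof -
  let ?J = "{1..N d \<alpha>}"
  obtain l where l: "mset l = (\<Sum>p\<in>UNIV \<times> ?J. replicate_mset (\<beta> (fst p) (snd p)) p)"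
    using ex_mset by blast
  have cnt: "count_list l p = (if snd p \<in> ?J then \<beta> (fst p) (snd p) else 0)" for p
    by (cases p) (simp add: count_mset[symmetric] l count_sum if_distrib cong: if_cong)
  have out: "\<beta> i j = 0" if "j \<notin> ?J" for i j using assms(2) that unfolding Sigma_set_def by blast
  have exps: "exponents_of_term l = \<beta>"
    using out by (auto simp: exponents_of_term_def cnt fun_eq_iff)
  have J: "snd ` set l \<subseteq> ?J"
  proof
    fix j assume "j \<in> snd ` set l"
    then obtain p where "p \<in> set l" "snd p = j" by auto
    then show "j \<in> ?J" using cnt[of p] count_list_0_iff[of l p] by (metis)
  qed
  have "type_of_term l = \<alpha>"
    using type_of_term_eq_sum_exponents[OF J] assms(2) by (simp add: exps Sigma_set_def fun_eq_iff)
  moreover have "(\<Sum>p\<leftarrow>l. snd p) = d + 1"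
    using weight_eq_sum_exponents[OF J] assms(2) by (simp add: exps Sigma_set_def)
  then have "l \<in> set (chain_terms es (d + 1))"
    using chain_terms_complete[OF assms(1), of l] J by (auto simp: image_subset_iff)
  ultimately show ?thesis using exps by blast
qed

lemma sum_list_group:
  fixes v :: "'k \<Rightarrow> real"
  assumes "finite S" "\<And>x. x \<in> set xs \<Longrightarrow> key x \<in> S"
  shows "(\<Sum>x\<leftarrow>xs. v (key x)) = (\<Sum>k\<in>S. real (length (filter (\<lambda>x. key x = k) xs)) * v k)"
  using assms(2)
proof (induction xs)
  case (Cons x xs)
  have "(\<Sum>k\<in>S. real (length (filter (\<lambda>x. key x = k) (x # xs))) * v k) =
     (\<Sum>k\<in>S. real (length (filter (\<lambda>x. key x = k) xs)) * v k + (if key x = k then v k else 0))"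
    by (intro sum.cong) (auto simp: algebra_simps)
  then show ?case using Cons assms(1) by (simp add: sum.distrib)
qed simp

section \<open>Degrees of the monomials and the order they must contain\<close>

lemma mono_deg_Sigma_set:
  assumes "\<beta> \<in> Sigma_set d \<alpha>"
  shows "mono_deg d \<alpha> (\<lambda>j. 1) \<beta> = mi_abs \<alpha>" "mono_deg d \<alpha> (\<lambda>j. j) \<beta> = d + 1"
  using assms by (simp_all add: Sigma_set_def mono_deg_def mi_abs_def)

text \<open>If all orders present were at most \<open>r\<close>, the weighted degree
  \<open>d + 1\<close> would be at most \<open>r\<close> times the plain degree
  \<open>mi_abs \<alpha>\<close>. It serves both claims on orders, with
  \<open>r = kappa d \<alpha> - 1\<close> and with \<open>r = 1\<close>.\<close>

lemma ex_high_order: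
  fixes \<alpha> :: "'n::finite \<Rightarrow> nat"
  assumes \<beta>: "\<beta> \<in> Sigma_set d \<alpha>" and r: "r * mi_abs \<alpha> < d + 1"
  shows "\<exists>i. \<exists>j\<in>{1..N d \<alpha>}. r + 1 \<le> j \<and> 0 < \<beta> i j"
proof (rule ccontr)
  assume "\<not> ?thesis"
  then have "j \<le> r \<or> \<beta> i j = 0" if "j \<in> {1..N d \<alpha>}" for i j
    using that by (metis Suc_eq_plus1 not_gr0 not_less_eq_eq)
  then have "j * \<beta> i j \<le> r * \<beta> i j" if "j \<in> {1..N d \<alpha>}" for i j
    using that by force
  then have "mono_deg d \<alpha> (\<lambda>j. j) \<beta> \<le> (\<Sum>i\<in>UNIV. \<Sum>j=1..N d \<alpha>. r * \<beta> i j)"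
    unfolding mono_deg_def by (intro sum_mono)
  also have "\<dots> = r * mono_deg d \<alpha> (\<lambda>j. 1) \<beta>" by (simp add: mono_deg_def sum_distrib_left)
  finally show False using r mono_deg_Sigma_set[OF \<beta>] by simp
qed

text \<open>\<open>kappa d \<alpha>\<close> is the ceiling of the quotient \<open>q\<close>, so its
  predecessor is strictly below \<open>q\<close>; clear the denominator.\<close>

lemma kappa_pred_mult_less:
  assumes "\<alpha> \<in> alphas d"
  shows "0 < kappa d \<alpha>" "(kappa d \<alpha> - 1) * mi_abs \<alpha> < d + 1"
proof -
  define m where "m = mi_abs \<alpha>"
  have m: "1 \<le> m" "m \<le> d + 1" using assms by (auto simp: alphas_def m_def)
  define q where "q = real (d + 1) / real m"
  have q: "q \<ge> 1" using m by (simp add: q_def)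
  \<comment> \<open>Thus \<open>nat\<close> changes nothing and the subtraction in
    \<open>kappa d \<alpha> - 1\<close> is not truncated.\<close>
  then have fl: "\<lfloor>q\<rfloor> \<ge> 1" by simp
  have \<kappa>: "kappa d \<alpha> = (if frac q = 0 then nat \<lfloor>q\<rfloor> else nat \<lfloor>q\<rfloor> + 1)"
    by (simp add: kappa_def q_def m_def Let_def)
  show pos: "0 < kappa d \<alpha>" using fl by (simp add: \<kappa>)
  have "real (kappa d \<alpha>) - 1 < q"
    using fl frac_ge_0[of q] unfolding \<kappa> frac_def by auto linarith
  then have "(real (kappa d \<alpha>) - 1) * real m < real (d + 1)"
    using m by (simp add: q_def pos_less_divide_eq)
  then have "real ((kappa d \<alpha> - 1) * m) < real (d + 1)"
    using pos by (simp add: of_nat_diff)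
  then show "(kappa d \<alpha> - 1) * mi_abs \<alpha> < d + 1" unfolding m_def of_nat_less_iff .
qed

section \<open>Derivatives along a curve\<close>

lemma has_real_derivative_sum_list:
  assumes "\<And>x. x \<in> set xs \<Longrightarrow> (v x has_real_derivative v' x) F"
  shows "((\<lambda>t. \<Sum>x\<leftarrow>xs. v x t) has_real_derivative (\<Sum>x\<leftarrow>xs. v' x)) F"
  using assms by (induction xs) (auto intro!: derivative_eq_intros)

lemma has_real_derivative_prod_orders:
  fixes u :: "'n \<Rightarrow> nat \<Rightarrow> real \<Rightarrow> real"
  assumes "\<And>p. p \<in> set l \<Longrightarrow>
      (u (fst p) (snd p) has_real_derivative u (fst p) (Suc (snd p)) t) (at t within A)"
  shows "((\<lambda>s. \<Prod>p\<leftarrow>l. u (fst p) (snd p) s) has_real_derivative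
      (\<Sum>l'\<leftarrow>raise_order l. \<Prod>p\<leftarrow>l'. u (fst p) (snd p) t)) (at t within A)"
  using assms
proof (induction l)
  case (Cons p l)
  have "((\<lambda>s. u (fst p) (snd p) s * (\<Prod>p\<leftarrow>l. u (fst p) (snd p) s)) has_real_derivative
      u (fst p) (Suc (snd p)) t * (\<Prod>p\<leftarrow>l. u (fst p) (snd p) t)
      + (\<Sum>l'\<leftarrow>raise_order l. \<Prod>p\<leftarrow>l'. u (fst p) (snd p) t) * u (fst p) (snd p) t) (at t within A)"
    using Cons by (intro DERIV_mult) auto
  then show ?case by (simp add: comp_def sum_list_const_mult mult.commute)
qed simp

text \<open>The partial of \<open>f\<close> follows the order of the list, so that prepending a pair
  is one more outer differentiation. The passage to \<open>mi_partial\<close> is postponed to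
  \<open>term_value_eq_monomial\<close>.\<close>

definition term_value ::
    "(real^'n \<Rightarrow> real) \<Rightarrow> (real \<Rightarrow> real^'n) \<Rightarrow> ('n \<times> nat) list \<Rightarrow> real \<Rightarrow> real" where
  "term_value f \<omega> l t =
     ball_partial (map (\<lambda>p. axis (fst p) 1) l) f (\<omega> t) *
     (\<Prod>p\<leftarrow>l. interval_deriv (snd p) (\<lambda>s. \<omega> s $ fst p) t)"

context
  fixes k :: nat and f :: "real^'n::finite \<Rightarrow> real" and \<omega> :: "real \<Rightarrow> real^'n"
  assumes f: "smooth_on_ball k f"
    and \<omega>_ball: "\<omega> ` {-1..1} \<subseteq> cball 0 1"
    and \<omega>: "\<And>i. smooth_on_ball k (\<lambda>t. \<omega> t $ i)"
begin

lemma curve_has_derivative: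
  assumes "0 < k" "t \<in> {-1..1}"
  shows "(\<omega> has_vector_derivative (\<chi> i. interval_deriv 1 (\<lambda>s. \<omega> s $ i) t)) (at t within {-1..1})"
proof -
  have "((\<lambda>t. \<omega> t $ i) has_real_derivative interval_deriv 1 (\<lambda>s. \<omega> s $ i) t) (at t within {-1..1})" for i
  proof (rule has_field_derivative_transform_within[OF _ zero_less_one assms(2)])
    show "(interval_deriv 0 (\<lambda>s. \<omega> s $ i) has_real_derivative interval_deriv 1 (\<lambda>s. \<omega> s $ i) t)
        (at t within {-1..1})"
      using interval_deriv_has_derivative[OF \<omega> assms] by simp
  qed (rule interval_deriv_0[OF \<omega>])
  then have "((\<lambda>t. \<omega> t \<bullet> axis i 1) has_derivative
      (\<lambda>h. (h *\<^sub>R (\<chi> i. interval_deriv 1 (\<lambda>s. \<omega> s $ i) t)) \<bullet> axis i 1)) (at t within {-1..1})" for i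
    by (simp add: has_field_derivative_def inner_axis mult.commute[of _ "interval_deriv _ _ _"])
  then show ?thesis
    unfolding has_vector_derivative_def
    by (subst has_derivative_componentwise_within) (auto simp: Basis_cart_eq_range)
qed

text \<open>The derivative relative to the closed ball restricts to the image of the curve, so the
  chain rule holds even where the curve meets the sphere.\<close>

lemma ball_partial_curve_has_derivative:
  assumes "set bs \<subseteq> Basis" "length bs < k" "t \<in> {-1..1}"
  shows "((\<lambda>s. ball_partial bs f (\<omega> s)) has_real_derivative
      (\<Sum>i\<in>UNIV. ball_partial (axis i 1 # bs) f (\<omega> t) * interval_deriv 1 (\<lambda>s. \<omega> s $ i) t))
    (at t within {-1..1})"
proof -
  let ?w = "\<chi> i. interval_deriv 1 (\<lambda>s. \<omega> s $ i) t"
  have "(ball_partial bs f has_derivative (\<lambda>h. \<Sum>b\<in>Basis. ball_partial (b # bs) f (\<omega> t) * (h \<bullet> b)))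
      (at (\<omega> t) within \<omega> ` {-1..1})"
    using assms(3) \<omega>_ball
    by (intro has_derivative_subset[OF ball_partial_has_derivative[OF f assms(1,2)] \<omega>_ball]) blast
  then have "((ball_partial bs f \<circ> \<omega>) has_vector_derivative
      (\<Sum>b\<in>Basis. ball_partial (b # bs) f (\<omega> t) * (?w \<bullet> b))) (at t within {-1..1})"
    using assms by (intro vector_derivative_diff_chain_within curve_has_derivative) auto
  moreover have "(\<Sum>b\<in>Basis. ball_partial (b # bs) f (\<omega> t) * (?w \<bullet> b)) =
      (\<Sum>i\<in>UNIV. ball_partial (axis i 1 # bs) f (\<omega> t) * interval_deriv 1 (\<lambda>s. \<omega> s $ i) t)"
    unfolding Basis_cart_eq_range
    by (subst sum.reindex) (auto simp: inj_on_def axis_eq_axis cart_eq_inner_axis[symmetric])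
  ultimately show ?thesis by (simp add: has_real_derivative_iff_has_vector_derivative comp_def)
qed

lemma term_value_has_derivative:
  assumes "\<And>p. p \<in> set l \<Longrightarrow> snd p < k" "length l < k" "t \<in> {-1..1}"
  shows "(term_value f \<omega> l has_real_derivative
      (\<Sum>i\<in>UNIV. term_value f \<omega> ((i, 1) # l) t) + (\<Sum>l'\<leftarrow>raise_order l. term_value f \<omega> l' t))
    (at t within {-1..1})"
proof -
  let ?bs = "map (\<lambda>p. axis (fst p) 1) l" and ?u = "\<lambda>i j. interval_deriv j (\<lambda>s. \<omega> s $ i)"
  have "((\<lambda>s. ball_partial ?bs f (\<omega> s) * (\<Prod>p\<leftarrow>l. ?u (fst p) (snd p) s)) has_real_derivative
      (\<Sum>i\<in>UNIV. ball_partial (axis i 1 # ?bs) f (\<omega> t) * ?u i 1 t) * (\<Prod>p\<leftarrow>l. ?u (fst p) (snd p) t)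
      + (\<Sum>l'\<leftarrow>raise_order l. \<Prod>p\<leftarrow>l'. ?u (fst p) (snd p) t) * ball_partial ?bs f (\<omega> t)) (at t within {-1..1})"
    using assms
    by (intro DERIV_mult ball_partial_curve_has_derivative has_real_derivative_prod_orders
        interval_deriv_has_derivative[OF \<omega>]) auto
  moreover have "(\<Sum>i\<in>UNIV. ball_partial (axis i 1 # ?bs) f (\<omega> t) * ?u i 1 t) * (\<Prod>p\<leftarrow>l. ?u (fst p) (snd p) t)
      = (\<Sum>i\<in>UNIV. term_value f \<omega> ((i, 1) # l) t)"
    by (simp add: term_value_def sum_distrib_right mult.assoc)
  moreover have "(\<Sum>l'\<leftarrow>raise_order l. \<Prod>p\<leftarrow>l'. ?u (fst p) (snd p) t) * ball_partial ?bs f (\<omega> t)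
      = (\<Sum>l'\<leftarrow>raise_order l. term_value f \<omega> l' t)"
  proof -
    \<comment> \<open>Raising an order leaves the coordinates alone, so all these terms share the
      same partial derivative of \<open>f\<close>.\<close>
    have "term_value f \<omega> l' t = (\<Prod>p\<leftarrow>l'. ?u (fst p) (snd p) t) * ball_partial ?bs f (\<omega> t)"
      if "l' \<in> set (raise_order l)" for l'
    proof -
      have "map (\<lambda>p. axis (fst p) (1::real)) l' = ?bs"
        using arg_cong[OF map_fst_raise_order[OF that], of "map (\<lambda>i. axis i 1)"] by (simp add: comp_def)
      then show ?thesis by (simp add: term_value_def)
    qed
    then show ?thesis
      unfolding sum_list_mult_const[symmetric]
      by (intro arg_cong[of _ _ sum_list] map_cong) simp_all
  qed
  ultimately show ?thesis by (simp add: term_value_def[abs_def])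
qed

text \<open>The sums over \<open>chain_terms es m\<close> form a family as in
  \<open>smooth_on_interval_family\<close>: differentiating all terms at level \<open>m\<close>
  yields exactly the list at level \<open>m + 1\<close>.\<close>

lemma chain_terms_derivative:
  assumes es: "distinct es" "set es = UNIV"
  shows "smooth_on_ball k (\<lambda>t. f (\<omega> t))"
    and "m \<le> k \<Longrightarrow> t \<in> {-1..1} \<Longrightarrow>
      interval_deriv m (\<lambda>t. f (\<omega> t)) t = (\<Sum>l\<leftarrow>chain_terms es m. term_value f \<omega> l t)"
proof -
  define S where "S m t = (\<Sum>l\<leftarrow>chain_terms es m. term_value f \<omega> l t)" for m t
  have S0: "S 0 t = f (\<omega> t)" if "t \<in> {-1..1}" for t
  proof -
    have "\<omega> t \<in> cball 0 1" using \<omega>_ball that by blast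
    then show ?thesis by (simp add: S_def term_value_def ball_partial_Nil[OF f])
  qed
  \<comment> \<open>At level \<open>m < k\<close> all orders and lengths stay below
    \<open>k\<close>, so every factor can be differentiated once more.\<close>
  have bounds: "snd p \<le> m" if "l \<in> set (chain_terms es m)" "p \<in> set l" for l p m
  proof -
    have "snd p + length l \<le> Suc m"
      using order_le_weight[of l p] chain_terms_pos_weight[OF that(1)] that(2) by simp
    then show ?thesis using length_pos_if_in_set[OF that(2)] by linarith
  qed
  have len: "length l \<le> m" if "l \<in> set (chain_terms es m)" for l m
    using chain_terms_pos_weight[OF that] length_le_weight[of l] by auto
  have der: "(S m has_real_derivative S (Suc m) t) (at t within {-1..1})"
    if "m < k" "t \<in> {-1..1}" for m t
  proof -
    have "(S m has_real_derivative (\<Sum>l\<leftarrow>chain_terms es m.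
        (\<Sum>i\<in>UNIV. term_value f \<omega> ((i, 1) # l) t) + (\<Sum>l'\<leftarrow>raise_order l. term_value f \<omega> l' t)))
        (at t within {-1..1})"
      unfolding S_def using that
      by (intro has_real_derivative_sum_list term_value_has_derivative le_less_trans[OF bounds]
          le_less_trans[OF len]) auto
    moreover have "(\<Sum>i\<in>UNIV. term_value f \<omega> ((i, 1) # l) t) = (\<Sum>i\<leftarrow>es. term_value f \<omega> ((i, 1) # l) t)" for l
      by (simp add: sum_list_distinct_conv_sum_set es)
    moreover have "(\<Sum>l\<leftarrow>concat (map h ls). term_value f \<omega> l t) =
        (\<Sum>l\<leftarrow>ls. \<Sum>l'\<leftarrow>h l. term_value f \<omega> l' t)"
      for h :: "('n \<times> nat) list \<Rightarrow> ('n \<times> nat) list list" and ls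
      by (induction ls) auto
    ultimately show ?thesis by (simp add: S_def comp_def)
  qed
  have "continuous_on {-1..1} (term_value f \<omega> l)" if l: "l \<in> set (chain_terms es k)" for l
  proof -
    have "continuous_on {-1..1} (\<lambda>t. \<omega> t $ i)" for i
      using \<omega>[of i] by (simp add: smooth_on_ball_def cball_real_eq)
    then have "continuous_on {-1..1} (\<lambda>t. \<chi> i. \<omega> t $ i)" by (rule continuous_on_vec_lambda)
    then have "continuous_on {-1..1} \<omega>" by simp
    moreover have "continuous_on (\<omega> ` {-1..1}) (ball_partial (map (\<lambda>p. axis (fst p) 1) l) f)"
      using len[OF l] by (intro continuous_on_subset[OF continuous_on_ball_partial[OF f] \<omega>_ball]) auto
    ultimately have "continuous_on {-1..1} (\<lambda>t. ball_partial (map (\<lambda>p. axis (fst p) 1) l) f (\<omega> t))"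
      using continuous_on_compose[of "{-1..1}" \<omega>] by (simp add: comp_def)
    moreover have "continuous_on {-1..1} (\<lambda>t. \<Prod>p\<leftarrow>l'. interval_deriv (snd p) (\<lambda>s. \<omega> s $ fst p) t)"
      if "set l' \<subseteq> set l" for l'
      using that
    proof (induction l')
      case (Cons p l')
      then have "continuous_on {-1..1} (interval_deriv (snd p) (\<lambda>s. \<omega> s $ fst p))"
        using bounds[OF l] by (intro continuous_on_interval_deriv[OF \<omega>]) auto
      then show ?case using Cons by (auto intro!: continuous_intros)
    qed simp
    ultimately show ?thesis
      unfolding term_value_def[abs_def] by (intro continuous_on_mult) auto
  qed
  then have "continuous_on {-1..1} (\<lambda>t. \<Sum>l\<leftarrow>ls. term_value f \<omega> l t)"
    if "set ls \<subseteq> set (chain_terms es k)" for ls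
    using that by (induction ls) (auto intro!: continuous_intros)
  then have cont: "continuous_on {-1..1} (S k)" unfolding S_def[abs_def] by simp
  show "smooth_on_ball k (\<lambda>t. f (\<omega> t))"
    by (rule smooth_on_interval_family(1)[where S = S, OF S0 der cont])
  show "m \<le> k \<Longrightarrow> t \<in> {-1..1} \<Longrightarrow>
      interval_deriv m (\<lambda>t. f (\<omega> t)) t = (\<Sum>l\<leftarrow>chain_terms es m. term_value f \<omega> l t)"
    unfolding S_def[symmetric]
    by (rule smooth_on_interval_family(2)[where S = S and k = k, OF S0 der cont])
qed

lemma term_value_eq_monomial:
  assumes "l \<in> set (chain_terms es (d + 1))" "d < k" "t \<in> {-1..1}"
  shows "term_value f \<omega> l t =
    mi_partial (type_of_term l) f (\<omega> t) * D_monomial d (type_of_term l) \<omega> t (exponents_of_term l)"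
proof -
  let ?J = "{1..N d (type_of_term l)}"
  let ?bs = "map (\<lambda>p. axis (fst p) 1 :: real^'n) l"
  have "\<omega> t \<in> cball 0 1" using \<omega>_ball assms by blast
  moreover have "length l \<le> k"
    using chain_terms_pos_weight[OF assms(1)] length_le_weight[of l] assms(2) by auto
  \<comment> \<open>Distinct coordinates have distinct axis vectors, so mapping to them preserves
    counts.\<close>
  moreover have "count_list ?bs (axis i 1) = type_of_term l i" for i
    using count_list_map_conv[of "\<lambda>i. axis i 1 :: real^'n" "map fst l" i]
    by (simp add: type_of_term_def inj_def axis_eq_axis comp_def)
  ultimately have "mi_partial (type_of_term l) f (\<omega> t) = ball_partial ?bs f (\<omega> t)"
    by (intro mi_partial_eq_ball_partial[OF f]) auto
  moreover have "set l \<subseteq> UNIV \<times> ?J" using chain_terms_order_le[OF assms(1)] by force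
  then have "(\<Prod>p\<leftarrow>l. interval_deriv (snd p) (\<lambda>s. \<omega> s $ fst p) t) =
      D_monomial d (type_of_term l) \<omega> t (exponents_of_term l)"
    by (subst prod_list_eq_prod_count[of "UNIV \<times> ?J"])
      (auto simp: D_monomial_def prod.cartesian_product exponents_of_term_def case_prod_beta)
  ultimately show ?thesis by (simp add: term_value_def)
qed

end

section \<open>Coefficients, their bounds, and the formula\<close>

definition chain_coeff :: "'n list \<Rightarrow> nat \<Rightarrow> ('n \<Rightarrow> nat) \<Rightarrow> ('n \<Rightarrow> nat \<Rightarrow> nat) \<Rightarrow> nat" where
  "chain_coeff es d \<alpha> \<beta> =
     length (filter (\<lambda>l. (type_of_term l, exponents_of_term l) = (\<alpha>, \<beta>)) (chain_terms es (d + 1)))"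

text \<open>Collects equal terms. \<open>v\<close> is arbitrary because it is taken once as the
  actual summand and once as the constant 1, which shows that the coefficients add up to the number
  of lists.\<close>

lemma sum_chain_terms_eq:
  fixes es :: "'n::finite list"
  shows "(\<Sum>l\<leftarrow>chain_terms es (d + 1). v (type_of_term l) (exponents_of_term l)) =
    (\<Sum>\<alpha>\<in>alphas d. \<Sum>\<beta>\<in>Sigma_set d \<alpha>. real (chain_coeff es d \<alpha> \<beta>) * v \<alpha> \<beta>)"
proof -
  have "(\<Sum>l\<leftarrow>chain_terms es (d + 1). v (type_of_term l) (exponents_of_term l)) =
     (\<Sum>l\<leftarrow>chain_terms es (d + 1). case_prod v (type_of_term l, exponents_of_term l))" by simp
  also have "\<dots> = (\<Sum>k\<in>Sigma (alphas d) (Sigma_set d). real (length (filter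
      (\<lambda>l. (type_of_term l, exponents_of_term l) = k) (chain_terms es (d + 1)))) * case_prod v k)"
    by (intro sum_list_group finite_SigmaI finite_alphas finite_Sigma_set SigmaI)
      (erule type_of_chain_term)+
  also have "\<dots> = (\<Sum>\<alpha>\<in>alphas d. \<Sum>\<beta>\<in>Sigma_set d \<alpha>. real (chain_coeff es d \<alpha> \<beta>) * v \<alpha> \<beta>)"
    by (subst sum.Sigma) (auto simp: finite_alphas finite_Sigma_set chain_coeff_def case_prod_beta intro!: sum.cong)
  finally show ?thesis .
qed

lemma chain_coeff_pos:
  fixes es :: "'n::finite list"
  assumes "set es = UNIV" "\<beta> \<in> Sigma_set d \<alpha>"
  shows "1 \<le> chain_coeff es d \<alpha> \<beta>"
  using ex_chain_term[OF assms] by (auto simp: chain_coeff_def Suc_le_eq filter_empty_conv)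

lemma chain_coeff_bounds:
  fixes es :: "'n::finite list" and d :: nat
  assumes es: "distinct es" "set es = UNIV"
  defines "M \<equiv> (CARD('n) + 1) ^ (d + 1) * (d + 1) ^ ((d + 1) * (CARD('n) + 2))"
  shows "(\<Sum>\<alpha>\<in>alphas d. \<Sum>\<beta>\<in>Sigma_set d \<alpha>. chain_coeff es d \<alpha> \<beta>) \<le> M"
    and "card (SIGMA \<alpha>:(alphas d :: ('n \<Rightarrow> nat) set). Sigma_set d \<alpha>) \<le> M"
    and "\<alpha> \<in> alphas d \<Longrightarrow> \<beta> \<in> Sigma_set d \<alpha> \<Longrightarrow> chain_coeff es d \<alpha> \<beta> \<le> M"
proof -
  let ?c = "\<Sum>\<alpha>\<in>alphas d. \<Sum>\<beta>\<in>Sigma_set d \<alpha>. chain_coeff es d \<alpha> \<beta>"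
  have "real ?c = real (length (chain_terms es (d + 1)))"
    using sum_chain_terms_eq[of "\<lambda>_ _. 1" es d] by (simp add: sum_list_triv)
  then have "?c = length (chain_terms es (d + 1))" by (simp only: of_nat_eq_iff)
  also have "\<dots> \<le> (CARD('n) + (d + 1)) ^ (d + 1)"
    using length_chain_terms[of es "d + 1"] es distinct_card[OF es(1)] by simp
  \<comment> \<open>\<open>n + d + 1\<close> is at most \<open>(n + 1) * (d + 1)\<close>; the
    exponent of the factor \<open>d + 1\<close> is then enlarged to the stated one.\<close>
  also have "\<dots> \<le> ((CARD('n) + 1) * (d + 1)) ^ (d + 1)"
    by (intro power_mono) (auto simp: algebra_simps)
  also have "\<dots> \<le> M"
    unfolding M_def power_mult_distrib by (intro mult_le_mono2 power_increasing) auto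
  finally show le: "?c \<le> M" .
  have "card (SIGMA \<alpha>:(alphas d :: ('n \<Rightarrow> nat) set). Sigma_set d \<alpha>) =
      (\<Sum>\<alpha>\<in>alphas d. \<Sum>\<beta>\<in>Sigma_set d (\<alpha> :: 'n \<Rightarrow> nat). 1)"
    by (simp add: card_SigmaI finite_alphas finite_Sigma_set)
  \<comment> \<open>Every coefficient is at least 1, so their sum also bounds the number of
    pairs.\<close>
  also have "\<dots> \<le> ?c" by (intro sum_mono chain_coeff_pos es)
  finally show "card (SIGMA \<alpha>:(alphas d :: ('n \<Rightarrow> nat) set). Sigma_set d \<alpha>) \<le> M" using le by simp
  assume "\<alpha> \<in> alphas d" "\<beta> \<in> Sigma_set d \<alpha>"
  then have "chain_coeff es d \<alpha> \<beta> \<le> (\<Sum>\<beta>\<in>Sigma_set d \<alpha>. chain_coeff es d \<alpha> \<beta>)"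
    "(\<Sum>\<beta>\<in>Sigma_set d \<alpha>. chain_coeff es d \<alpha> \<beta>) \<le> ?c"
    by (auto intro!: member_le_sum finite_alphas finite_Sigma_set)
  then show "chain_coeff es d \<alpha> \<beta> \<le> M" using le by linarith
qed

theorem proposition2p1:
  fixes d :: nat
  shows "\<exists>c :: ('n::finite \<Rightarrow> nat) \<Rightarrow> ('n \<Rightarrow> nat \<Rightarrow> nat) \<Rightarrow> real.
    (\<forall>(f :: real^'n \<Rightarrow> real) (\<omega> :: real \<Rightarrow> real^'n).
       smooth_on_ball (d + 1) f \<and>
       \<omega> ` {-1..1} \<subseteq> cball 0 1 \<and>
       (\<forall>i. smooth_on_ball (d + 1) (\<lambda>t. \<omega> t $ i)) \<longrightarrow>
         smooth_on_ball (d + 1) (\<lambda>t. f (\<omega> t)) \<and>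
         (\<forall>t\<in>{-1..1}.
            interval_deriv (d + 1) (\<lambda>t. f (\<omega> t)) t =
              (\<Sum>\<alpha>\<in>alphas d. mi_partial \<alpha> f (\<omega> t) *
                 (\<Sum>\<beta>\<in>Sigma_set d \<alpha>. c \<alpha> \<beta> * D_monomial d \<alpha> \<omega> t \<beta>)))) \<and>
    (\<forall>\<alpha>\<in>(alphas d :: ('n \<Rightarrow> nat) set). \<forall>\<beta>\<in>Sigma_set d \<alpha>.
       mono_deg d \<alpha> (\<lambda>j. 1) \<beta> = mi_abs \<alpha> \<and>
       mono_deg d \<alpha> (\<lambda>j. j) \<beta> = d + 1) \<and>
    (let M = (CARD('n) + 1) ^ (d + 1) * (d + 1) ^ ((d + 1) * (CARD('n) + 2)) in
       (\<forall>\<alpha>\<in>alphas d. \<forall>\<beta>\<in>Sigma_set d \<alpha>. c \<alpha> \<beta> \<in> \<int> \<and> c \<alpha> \<beta> \<noteq> 0) \<and>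
       \<bar>\<Sum>\<alpha>\<in>alphas d. \<Sum>\<beta>\<in>Sigma_set d \<alpha>. c \<alpha> \<beta>\<bar> \<le> real M \<and>
       (\<forall>\<alpha>\<in>alphas d. \<forall>\<beta>\<in>Sigma_set d \<alpha>. \<bar>c \<alpha> \<beta>\<bar> \<le> real M) \<and>
       card (SIGMA \<alpha>:(alphas d :: ('n \<Rightarrow> nat) set). Sigma_set d \<alpha>) \<le> M) \<and>
    (\<forall>\<alpha>\<in>(alphas d :: ('n \<Rightarrow> nat) set). \<forall>\<beta>\<in>Sigma_set d \<alpha>.
       (\<exists>i. \<exists>j\<in>{1..N d \<alpha>}. kappa d \<alpha> \<le> j \<and> 0 < \<beta> i j) \<and>
       (mi_abs \<alpha> \<le> d \<longrightarrow> (\<exists>i. \<exists>j\<in>{1..N d \<alpha>}. 2 \<le> j \<and> 0 < \<beta> i j)))"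
proof -
  \<comment> \<open>The enumeration is fixed before \<open>f\<close> and \<open>\<omega>\<close>, so
    the coefficients do not depend on them.\<close>
  obtain es :: "'n list" where es: "set es = UNIV" "distinct es"
    using finite_distinct_list[of "UNIV :: 'n set"] by auto
  show ?thesis
  proof (intro exI[of _ "\<lambda>\<alpha> \<beta>. real (chain_coeff es d \<alpha> \<beta>)"] conjI allI impI ballI; (elim conjE)?)
    fix f :: "real^'n \<Rightarrow> real" and \<omega> :: "real \<Rightarrow> real^'n"
    assume f: "smooth_on_ball (d + 1) f" and \<omega>: "\<omega> ` {-1..1} \<subseteq> cball 0 1"
      "\<forall>i. smooth_on_ball (d + 1) (\<lambda>t. \<omega> t $ i)"
    note chain = chain_terms_derivative[OF f \<omega>(1) spec[OF \<omega>(2)] es(2,1)]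
    show "smooth_on_ball (d + 1) (\<lambda>t. f (\<omega> t))" by (rule chain(1))
    fix t :: real assume t: "t \<in> {-1..1}"
    have "interval_deriv (d + 1) (\<lambda>t. f (\<omega> t)) t =
        (\<Sum>l\<leftarrow>chain_terms es (d + 1). term_value f \<omega> l t)"
      using chain(2)[of "d + 1" t] t by simp
    also have "\<dots> = (\<Sum>l\<leftarrow>chain_terms es (d + 1).
        mi_partial (type_of_term l) f (\<omega> t) * D_monomial d (type_of_term l) \<omega> t (exponents_of_term l))"
      by (intro arg_cong[of _ _ sum_list] map_cong refl term_value_eq_monomial[OF f \<omega>(1) spec[OF \<omega>(2)]])
        (use t in auto)
    also have "\<dots> = (\<Sum>\<alpha>\<in>alphas d. \<Sum>\<beta>\<in>Sigma_set d \<alpha>.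
        real (chain_coeff es d \<alpha> \<beta>) * (mi_partial \<alpha> f (\<omega> t) * D_monomial d \<alpha> \<omega> t \<beta>))"
      by (rule sum_chain_terms_eq)
    finally show "interval_deriv (d + 1) (\<lambda>t. f (\<omega> t)) t =
        (\<Sum>\<alpha>\<in>alphas d. mi_partial \<alpha> f (\<omega> t) *
          (\<Sum>\<beta>\<in>Sigma_set d \<alpha>. real (chain_coeff es d \<alpha> \<beta>) * D_monomial d \<alpha> \<omega> t \<beta>))"
      by (simp add: sum_distrib_left mult.left_commute)
  next
    show "let M = (CARD('n) + 1) ^ (d + 1) * (d + 1) ^ ((d + 1) * (CARD('n) + 2)) in
       (\<forall>\<alpha>\<in>alphas d. \<forall>\<beta>\<in>Sigma_set d \<alpha>.
          real (chain_coeff es d \<alpha> \<beta>) \<in> \<int> \<and> real (chain_coeff es d \<alpha> \<beta>) \<noteq> 0) \<and>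
       \<bar>\<Sum>\<alpha>\<in>alphas d. \<Sum>\<beta>\<in>Sigma_set d \<alpha>. real (chain_coeff es d \<alpha> \<beta>)\<bar> \<le> real M \<and>
       (\<forall>\<alpha>\<in>alphas d. \<forall>\<beta>\<in>Sigma_set d \<alpha>. \<bar>real (chain_coeff es d \<alpha> \<beta>)\<bar> \<le> real M) \<and>
       card (SIGMA \<alpha>:(alphas d :: ('n \<Rightarrow> nat) set). Sigma_set d \<alpha>) \<le> M"
      unfolding Let_def of_nat_sum[symmetric] abs_of_nat of_nat_le_iff
      using chain_coeff_bounds[OF es(2,1), where d = d] chain_coeff_pos[OF es(1), where d = d]
      by (auto simp: Suc_le_eq)
  next
    fix \<alpha> :: "'n \<Rightarrow> nat" and \<beta> assume \<alpha>: "\<alpha> \<in> alphas d" and \<beta>: "\<beta> \<in> Sigma_set d \<alpha>"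
    show "mono_deg d \<alpha> (\<lambda>j. 1) \<beta> = mi_abs \<alpha>" "mono_deg d \<alpha> (\<lambda>j. j) \<beta> = d + 1"
      by (rule mono_deg_Sigma_set[OF \<beta>])+
    show "\<exists>i. \<exists>j\<in>{1..N d \<alpha>}. kappa d \<alpha> \<le> j \<and> 0 < \<beta> i j"
      using ex_high_order[OF \<beta> kappa_pred_mult_less(2)[OF \<alpha>]] kappa_pred_mult_less(1)[OF \<alpha>] by simp
    assume "mi_abs \<alpha> \<le> d"
    \<comment> \<open>For \<open>r = 1\<close> the hypothesis of \<open>ex_high_order\<close> reads
      \<open>mi_abs \<alpha> < d + 1\<close>.\<close>
    then show "\<exists>i. \<exists>j\<in>{1..N d \<alpha>}. 2 \<le> j \<and> 0 < \<beta> i j"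
      using ex_high_order[OF \<beta>, of 1] by (simp add: numeral_2_eq_2)
  qed
qed

end
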